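(* Let $n\ge 3$ and let $M=I\times\mathbb{S}^{n-1}$, where $I\subset(0,\infty)$ is an open interval, with metric $g=dr^2+\tanh(r)^2\,g_{\mathbb{S}^{n-1}}$, where $g_{\mathbb{S}^{n-1}}$ is the canonical metric of the unit sphere and $r\in I$. Then $(M^n,g,f)$ is a static perfect fluid space with lapse function $$f(r)=A\sin\left(\sqrt{n-2}\,\log\cosh r\right)+B\cos\left(\sqrt{n-2}\,\log\cosh r\right),\qquad A,B\in\mathbb{R}$$ (on intervals $I$ where $f>0$). Moreover, $(M^n,g,f)$ has positive sectional curvature, and the metric $dr^2+\tanh(r)^2 g_{\mathbb{S}^{n-1}}$ on $(0,\infty)\times\mathbb{S}^{n-1}$ extends to a smooth metric through the origin $r=0$.
   Context: A static perfect fluid space $(M^n,g,f,\rho)$ is a Riemannian manifold $(M^n,g)$ with smooth functions $f>0$ (the lapse function) and $\rho,\mu$ on $M$ satisfying $$f\,Ric=\nabla^2 f+\frac{\mu-\rho}{n-1}\,f\,g,\qquad \Delta f=\frac{(n-2)\mu+n\rho}{n-1}\,f,\qquad \mu=\frac{R}{2}.$$ Equivalently (with $\mu$, $\rho$ then determined by $R$ and $\Delta f/f$), $f\,\mathring{R}ic=\mathring{\nabla}^2 f$, where $\mathring{T}=T-\frac1n\mathrm{trace}(T)g$ denotes the traceless part of a symmetric 2-tensor $T$. *)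

theory Defs
  imports "HOL-Analysis.Analysis"
begin

text \<open>
  Manifolds are embedded submanifolds of a Euclidean space, of dimension \<open>CARD('n)\<close>; tensor
  identities are required in all local coordinates. The local coordinate formulas are the
  classical ones.
\<close>

subsection \<open>Smooth maps and embedded submanifolds\<close>

primrec times_cont_diff_on ::
  "nat \<Rightarrow> 'a::euclidean_space set \<Rightarrow> ('a \<Rightarrow> 'b::real_normed_vector) \<Rightarrow> bool" where
  "times_cont_diff_on 0 S f \<longleftrightarrow> continuous_on S f"
| "times_cont_diff_on (Suc k) S f \<longleftrightarrow>
     (\<forall>x\<in>S. f differentiable (at x)) \<and>
     (\<forall>v. times_cont_diff_on k S (\<lambda>x. frechet_derivative f (at x) v))"

text \<open>Only meaningful for open \<open>S\<close>, as derivatives are taken in full neighbourhoods.\<close>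

definition smooth_on :: "'a::euclidean_space set \<Rightarrow> ('a \<Rightarrow> 'b::real_normed_vector) \<Rightarrow> bool" where
  "smooth_on S f \<longleftrightarrow> (\<forall>k. times_cont_diff_on k S f)"

definition local_param ::
  "'a::euclidean_space set \<Rightarrow> (real^'n) set \<Rightarrow> (real^'n \<Rightarrow> 'a) \<Rightarrow> bool" where
  "local_param M U \<phi> \<longleftrightarrow>
     open U \<and> smooth_on U \<phi> \<and>
     (\<forall>u\<in>U. inj (frechet_derivative \<phi> (at u))) \<and>
     openin (top_of_set M) (\<phi> ` U) \<and> (\<exists>\<psi>. homeomorphism U (\<phi> ` U) \<phi> \<psi>)"

definition smooth_submanifold :: "'n::finite itself \<Rightarrow> 'a::euclidean_space set \<Rightarrow> bool" where
  "smooth_submanifold _ M \<longleftrightarrow>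
     (\<forall>p\<in>M. \<exists>(U :: (real^'n) set) \<phi>. local_param M U \<phi> \<and> p \<in> \<phi> ` U)"

definition smooth_function ::
  "'n::finite itself \<Rightarrow> 'a::euclidean_space set \<Rightarrow> ('a \<Rightarrow> real) \<Rightarrow> bool" where
  "smooth_function _ M f \<longleftrightarrow>
     (\<forall>(U :: (real^'n) set) \<phi>. local_param M U \<phi> \<longrightarrow> smooth_on U (f \<circ> \<phi>))"

definition tangent_space :: "'a::euclidean_space set \<Rightarrow> 'a \<Rightarrow> 'a set" where
  "tangent_space M p =
     {v. \<exists>\<epsilon>>0. \<exists>\<gamma> :: real \<Rightarrow> 'a. smooth_on {-\<epsilon><..<\<epsilon>} \<gamma> \<and> \<gamma> ` {-\<epsilon><..<\<epsilon>} \<subseteq> M \<and>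
        \<gamma> 0 = p \<and> (\<gamma> has_vector_derivative v) (at 0)}"

subsection \<open>Riemannian metrics\<close>

text \<open>
  A metric on \<open>M\<close> is a function \<open>g\<close> such that \<open>g p v w\<close> is the inner product of tangent vectors
  \<open>v\<close>, \<open>w\<close> at \<open>p \<in> M\<close>; its values on other arguments are irrelevant.
\<close>

definition pullback ::
  "('m::real_normed_vector \<Rightarrow> 'a::real_normed_vector) \<Rightarrow> ('a \<Rightarrow> 'a \<Rightarrow> 'a \<Rightarrow> real) \<Rightarrow>
     'm \<Rightarrow> 'm \<Rightarrow> 'm \<Rightarrow> real" where
  "pullback \<phi> g u v w =
     g (\<phi> u) (frechet_derivative \<phi> (at u) v) (frechet_derivative \<phi> (at u) w)"

definition riemannian_manifold ::
  "'n::finite itself \<Rightarrow> 'a::euclidean_space set \<Rightarrow> ('a \<Rightarrow> 'a \<Rightarrow> 'a \<Rightarrow> real) \<Rightarrow> bool" where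
  "riemannian_manifold T M g \<longleftrightarrow>
     smooth_submanifold T M \<and>
     (\<forall>(U :: (real^'n) set) \<phi>. local_param M U \<phi> \<longrightarrow>
        (\<forall>u\<in>U. bilinear (pullback \<phi> g u) \<and>
           (\<forall>v w. pullback \<phi> g u v w = pullback \<phi> g u w v) \<and>
           (\<forall>v. v \<noteq> 0 \<longrightarrow> pullback \<phi> g u v v > 0)) \<and>
        (\<forall>v w. smooth_on U (\<lambda>u. pullback \<phi> g u v w)))"

subsection \<open>Curvature, Hessian and Laplacian in local coordinates\<close>

definition pd :: "'n::finite \<Rightarrow> (real^'n \<Rightarrow> real) \<Rightarrow> real^'n \<Rightarrow> real" where
  "pd i F u = frechet_derivative F (at u) (axis i 1)"

definition metric_matrix ::
  "(real^'n \<Rightarrow> 'a::real_normed_vector) \<Rightarrow> ('a \<Rightarrow> 'a \<Rightarrow> 'a \<Rightarrow> real) \<Rightarrow> real^'n \<Rightarrow> real^'n^'n" where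
  "metric_matrix \<phi> g u = (\<chi> i j. pullback \<phi> g u (axis i 1) (axis j 1))"

text \<open>\<open>christoffel G u k i j\<close> is \<open>\<Gamma>\<^sup>k\<^sub>i\<^sub>j\<close>.\<close>

definition christoffel :: "(real^'n \<Rightarrow> real^'n^'n) \<Rightarrow> real^'n \<Rightarrow> 'n::finite \<Rightarrow> 'n \<Rightarrow> 'n \<Rightarrow> real" where
  "christoffel G u k i j =
     (1/2) * (\<Sum>l\<in>UNIV. matrix_inv (G u) $ k $ l *
       (pd i (\<lambda>x. G x $ j $ l) u + pd j (\<lambda>x. G x $ i $ l) u - pd l (\<lambda>x. G x $ i $ j) u))"

text \<open>
  \<open>riemann G u l i j k\<close> is the \<open>l\<close>-th component of \<open>R(\<partial>\<^sub>i, \<partial>\<^sub>j)\<partial>\<^sub>k\<close>, with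
  \<open>R(X, Y) = \<nabla>\<^sub>X\<nabla>\<^sub>Y - \<nabla>\<^sub>Y\<nabla>\<^sub>X - \<nabla>\<^bsub>[X, Y]\<^esub>\<close>.
\<close>

definition riemann ::
  "(real^'n \<Rightarrow> real^'n^'n) \<Rightarrow> real^'n \<Rightarrow> 'n::finite \<Rightarrow> 'n \<Rightarrow> 'n \<Rightarrow> 'n \<Rightarrow> real" where
  "riemann G u l i j k =
     pd i (\<lambda>x. christoffel G x l j k) u - pd j (\<lambda>x. christoffel G x l i k) u +
     (\<Sum>m\<in>UNIV. christoffel G u l i m * christoffel G u m j k -
                  christoffel G u l j m * christoffel G u m i k)"

definition ricci :: "(real^'n \<Rightarrow> real^'n^'n) \<Rightarrow> real^'n \<Rightarrow> 'n::finite \<Rightarrow> 'n \<Rightarrow> real" where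
  "ricci G u j k = (\<Sum>i\<in>UNIV. riemann G u i i j k)"

definition scalar_curvature :: "(real^'n \<Rightarrow> real^'n^'n) \<Rightarrow> real^'n::finite \<Rightarrow> real" where
  "scalar_curvature G u =
     (\<Sum>j\<in>UNIV. \<Sum>k\<in>UNIV. matrix_inv (G u) $ j $ k * ricci G u j k)"

definition metric_inner :: "(real^'n \<Rightarrow> real^'n^'n) \<Rightarrow> real^'n \<Rightarrow> real^'n \<Rightarrow> real^'n::finite \<Rightarrow> real" where
  "metric_inner G u v w = (\<Sum>i\<in>UNIV. \<Sum>j\<in>UNIV. G u $ i $ j * v $ i * w $ j)"

definition riemann_op ::
  "(real^'n \<Rightarrow> real^'n^'n) \<Rightarrow> real^'n \<Rightarrow> real^'n \<Rightarrow> real^'n \<Rightarrow> real^'n \<Rightarrow> real^'n::finite" where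
  "riemann_op G u v w z =
     (\<chi> l. \<Sum>i\<in>UNIV. \<Sum>j\<in>UNIV. \<Sum>k\<in>UNIV. riemann G u l i j k * v $ i * w $ j * z $ k)"

definition sectional_curvature ::
  "(real^'n \<Rightarrow> real^'n^'n) \<Rightarrow> real^'n \<Rightarrow> real^'n \<Rightarrow> real^'n::finite \<Rightarrow> real" where
  "sectional_curvature G u v w =
     metric_inner G u (riemann_op G u v w w) v /
     (metric_inner G u v v * metric_inner G u w w - (metric_inner G u v w)\<^sup>2)"

definition hessian ::
  "(real^'n \<Rightarrow> real^'n^'n) \<Rightarrow> (real^'n \<Rightarrow> real) \<Rightarrow> real^'n \<Rightarrow> 'n::finite \<Rightarrow> 'n \<Rightarrow> real" where
  "hessian G F u i j = pd i (pd j F) u - (\<Sum>k\<in>UNIV. christoffel G u k i j * pd k F u)"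

definition laplacian :: "(real^'n \<Rightarrow> real^'n^'n) \<Rightarrow> (real^'n \<Rightarrow> real) \<Rightarrow> real^'n::finite \<Rightarrow> real" where
  "laplacian G F u = (\<Sum>i\<in>UNIV. \<Sum>j\<in>UNIV. matrix_inv (G u) $ i $ j * hessian G F u i j)"

subsection \<open>Static perfect fluid spaces and positive sectional curvature\<close>

definition static_perfect_fluid_space ::
  "'n::finite itself \<Rightarrow> 'a::euclidean_space set \<Rightarrow> ('a \<Rightarrow> 'a \<Rightarrow> 'a \<Rightarrow> real) \<Rightarrow>
     ('a \<Rightarrow> real) \<Rightarrow> ('a \<Rightarrow> real) \<Rightarrow> ('a \<Rightarrow> real) \<Rightarrow> bool" where
  "static_perfect_fluid_space T M g f \<rho> \<mu> \<longleftrightarrow>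
     riemannian_manifold T M g \<and>
     smooth_function T M f \<and> smooth_function T M \<rho> \<and> smooth_function T M \<mu> \<and>
     (\<forall>p\<in>M. f p > 0) \<and>
     (\<forall>(U :: (real^'n) set) \<phi>. local_param M U \<phi> \<longrightarrow>
        (\<forall>u\<in>U. let G = metric_matrix \<phi> g; n = real CARD('n) in
           (\<forall>i j. f (\<phi> u) * ricci G u i j =
              hessian G (f \<circ> \<phi>) u i j
                + (\<mu> (\<phi> u) - \<rho> (\<phi> u)) / (n - 1) * f (\<phi> u) * G u $ i $ j) \<and>
           laplacian G (f \<circ> \<phi>) u =
             ((n - 2) * \<mu> (\<phi> u) + n * \<rho> (\<phi> u)) / (n - 1) * f (\<phi> u) \<and>
           \<mu> (\<phi> u) = scalar_curvature G u / 2))"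

definition positive_sectional_curvature ::
  "'n::finite itself \<Rightarrow> 'a::euclidean_space set \<Rightarrow> ('a \<Rightarrow> 'a \<Rightarrow> 'a \<Rightarrow> real) \<Rightarrow> bool" where
  "positive_sectional_curvature _ M g \<longleftrightarrow>
     (\<forall>(U :: (real^'n) set) \<phi>. local_param M U \<phi> \<longrightarrow>
        (\<forall>u\<in>U. \<forall>v w. v \<noteq> w \<and> independent {v, w} \<longrightarrow>
           sectional_curvature (metric_matrix \<phi> g) u v w > 0))"

subsection \<open>Rotationally symmetric metrics\<close>

text \<open>
  The metric \<open>dr\<^sup>2 + h(r)\<^sup>2 g\<^sub>S\<close> on \<open>I \<times> sphere 0 1\<close>, where the canonical metric \<open>g\<^sub>S\<close> of the unit
  sphere is the restriction of the Euclidean inner product to its tangent spaces.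
\<close>

definition warped_metric ::
  "(real \<Rightarrow> real) \<Rightarrow> real \<times> (real^'n) \<Rightarrow> real \<times> (real^'n) \<Rightarrow> real \<times> (real^'n) \<Rightarrow> real" where
  "warped_metric h p v w = fst v * fst w + (h (fst p))\<^sup>2 * (snd v \<bullet> snd w)"

text \<open>
  Polar coordinates \<open>(r, \<theta>) \<mapsto> r\<theta>\<close> identify \<open>(0, \<infinity>) \<times> sphere 0 1\<close> with the complement of the
  origin in \<open>real^'n\<close>, so that \<open>r = 0\<close> corresponds to the origin.
\<close>

definition polar :: "real \<times> (real^'n) \<Rightarrow> real^'n" where
  "polar p = fst p *\<^sub>R snd p"

definition extends_smoothly_through_origin ::
  "(real \<times> (real^'n) \<Rightarrow> real \<times> (real^'n) \<Rightarrow> real \<times> (real^'n) \<Rightarrow> real) \<Rightarrow> bool" where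
  "extends_smoothly_through_origin g \<longleftrightarrow>
     (\<exists>g'. riemannian_manifold TYPE('n) (UNIV :: (real^'n) set) g' \<and>
        (\<forall>p \<in> {0<..} \<times> sphere 0 1.
           \<forall>v \<in> tangent_space ({0<..} \<times> sphere 0 1) p.
           \<forall>w \<in> tangent_space ({0<..} \<times> sphere 0 1) p.
             pullback polar g' p v w = g p v w))"

end

theory Submission imports Defs begin

text \<open>
  In an arbitrary chart write \<open>\<phi> = (r, \<theta>)\<close> with \<open>|\<theta>| = 1\<close>. The vectors \<open>\<partial>\<^sub>k\<phi>\<close> span \<open>\<real> \<times> \<theta>\<^sup>\<bottom>\<close>, which gives
  Gauss formulas expressing \<open>\<partial>\<^sub>i\<partial>\<^sub>jr\<close> and \<open>\<partial>\<^sub>i\<partial>\<^sub>j\<theta>\<close> through \<open>\<Gamma>\<^sup>k\<^sub>i\<^sub>j\<close> and first derivatives.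
  Their integrability conditions (symmetry of third derivatives) determine the curvature of
  \<open>dr\<^sup>2 + h\<^sup>2 g\<^sub>S\<close>: planes containing \<open>\<partial>\<^sub>r\<close> have curvature \<open>-h''/h\<close>, planes orthogonal to it have curvature
  \<open>(1 - h'\<^sup>2)/h\<^sup>2\<close>. For \<open>h = tanh\<close> both are positive, and the fluid equation reduces to
  \<open>f'' - (h'/h) f' = -(n - 2) tanh\<^sup>2 f\<close>, solved by \<open>sin\<close> and \<open>cos\<close> of \<open>\<surd>(n - 2) log cosh r\<close>.
  Since \<open>tanh r / r\<close> is a smooth function of \<open>r\<^sup>2\<close>, the metric extends over the origin.
\<close>

section \<open>Calculus of smooth maps\<close>

text \<open>Every notion quantifies over all charts, so a computation in one polar chart would still
  require the invariance of curvature under coordinate changes. Keeping both components of a chart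
  as functions into the ambient space avoids this: each identity is verified in every chart at once.
  The inverse metric stays implicit; vectors are identified by their images under the injective
  derivative of the chart, and traces follow from tr G = n and |dr| = 1. The warped metric is not
  the one induced from R x R^n, whence the correction terms with h and h' in the Gauss formulas.

  The lapse comes from a change of variable: if s is an antiderivative of h, then f'' - (h'/h) f' =
  h^2 d^2f/ds^2. The vanishing of the traceless part thus reads d^2f/ds^2 = -(n - 2) h^(-2) (h''/h +
  (1 - h'^2)/h^2) f. For h = tanh the factor between n - 2 and f is 1 and s = log cosh r, so this is
  a harmonic oscillator of frequency sqrt(n - 2).\<close>

lemma times_cont_diff_on_cong:
  assumes "open S" "\<And>x. x \<in> S \<Longrightarrow> f x = g x"
  shows "times_cont_diff_on k S f \<longleftrightarrow> times_cont_diff_on k S g"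
  using assms(2)
proof (induction k arbitrary: f g)
  case 0
  then show ?case by (simp cong: continuous_on_cong)
next
  case (Suc k)
  have imp: "times_cont_diff_on (Suc k) S q"
    if p: "times_cont_diff_on (Suc k) S p" and eq: "\<And>x. x \<in> S \<Longrightarrow> p x = q x" for p q :: "'a \<Rightarrow> 'b"
  proof -
    have d: "q differentiable (at x)" if "x \<in> S" for x
      using p eq that has_derivative_transform_within_open[OF _ \<open>open S\<close> that, of p _ UNIV q]
      unfolding times_cont_diff_on.simps differentiable_def by blast
    have "frechet_derivative p (at x) = frechet_derivative q (at x)" if "x \<in> S" for x
      by (rule frechet_derivative_transform_within_open[OF _ \<open>open S\<close> that])
        (use p eq that in auto)
    then have "times_cont_diff_on k S (\<lambda>x. frechet_derivative q (at x) v)" for v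
      using Suc.IH[of "\<lambda>x. frechet_derivative p (at x) v" "\<lambda>x. frechet_derivative q (at x) v"] p
      by simp
    with d show ?thesis by simp
  qed
  show ?case
    by (rule iffI; erule imp) (simp_all add: Suc.prems)
qed

text \<open>Closure proofs can thus exhibit an explicit derivative \<open>f'\<close> and leave
  \<open>frechet_derivative\<close> aside; openness of \<open>S\<close> makes the two
  interchangeable at every order.\<close>

lemma times_cont_diff_on_SucI:
  assumes "open S" "\<And>x. x \<in> S \<Longrightarrow> (f has_derivative f' x) (at x)"
    "\<And>v. times_cont_diff_on k S (\<lambda>x. f' x v)"
  shows "times_cont_diff_on (Suc k) S f"
proof -
  have "frechet_derivative f (at x) = f' x" if "x \<in> S" for x
    using frechet_derivative_at[OF assms(2)[OF that]] by simp
  then have "times_cont_diff_on k S (\<lambda>x. frechet_derivative f (at x) v)" for v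
    using assms(3)[of v] times_cont_diff_on_cong[OF \<open>open S\<close>, of "\<lambda>x. frechet_derivative f (at x) v"
        "\<lambda>x. f' x v"] by simp
  then show ?thesis
    using assms(2) unfolding times_cont_diff_on.simps differentiable_def by blast
qed

lemma times_cont_diff_on_SucD: "times_cont_diff_on (Suc k) S f \<Longrightarrow> times_cont_diff_on k S f"
proof (induction k arbitrary: f)
  case 0
  then show ?case
    by (auto intro!: continuous_at_imp_continuous_on differentiable_imp_continuous_within)
next
  case (Suc k)
  have "times_cont_diff_on k S (\<lambda>x. frechet_derivative f (at x) v)" for v
    using Suc.prems by (intro Suc.IH) simp
  with Suc.prems show ?case by simp
qed

lemma times_cont_diff_on_const: "open S \<Longrightarrow> times_cont_diff_on k S (\<lambda>x. c)"
proof (induction k arbitrary: c)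
  case (Suc k)
  then show ?case by (intro times_cont_diff_on_SucI[where f' = "\<lambda>x v. 0"]) auto
qed simp

lemma times_cont_diff_on_add:
  assumes "open S" "times_cont_diff_on k S f" "times_cont_diff_on k S g"
  shows "times_cont_diff_on k S (\<lambda>x. f x + g x)"
  using assms(2,3)
proof (induction k arbitrary: f g)
  case 0
  then show ?case by (simp add: continuous_on_add)
next
  case (Suc k)
  then show ?case
    by (intro times_cont_diff_on_SucI[OF \<open>open S\<close>,
        where f' = "\<lambda>x v. frechet_derivative f (at x) v + frechet_derivative g (at x) v"])
      (auto intro!: has_derivative_add simp: frechet_derivative_works)
qed

lemma times_cont_diff_on_bounded_linear:
  assumes "open S" "bounded_linear L" "times_cont_diff_on k S f"
  shows "times_cont_diff_on k S (\<lambda>x. L (f x))"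
  using assms(3)
proof (induction k arbitrary: f)
  case 0
  then show ?case by (simp add: bounded_linear.continuous_on[OF assms(2)])
next
  case (Suc k)
  then show ?case
    by (intro times_cont_diff_on_SucI[OF \<open>open S\<close>,
        where f' = "\<lambda>x v. L (frechet_derivative f (at x) v)"])
      (auto intro!: bounded_linear.has_derivative[OF assms(2)] simp: frechet_derivative_works)
qed

text \<open>The product rule returns the factors themselves next to their derivatives, so the
  induction step also uses \<open>f\<close> and \<open>g\<close> at the lower order. Scaling, inner
  products and real products are all instances.\<close>

lemma times_cont_diff_on_bilinear:
  assumes "open S" "bounded_bilinear B" "times_cont_diff_on k S f" "times_cont_diff_on k S g"
  shows "times_cont_diff_on k S (\<lambda>x. B (f x) (g x))"
  using assms(3,4)
proof (induction k arbitrary: f g)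
  case 0
  then show ?case by (simp add: bounded_bilinear.continuous_on[OF assms(2)])
next
  case (Suc k)
  have *: "times_cont_diff_on k S f" "times_cont_diff_on k S g"
    using Suc.prems by (blast intro: times_cont_diff_on_SucD)+
  show ?case
    by (rule times_cont_diff_on_SucI[OF \<open>open S\<close>, where f' = "\<lambda>x v.
          B (f x) (frechet_derivative g (at x) v) + B (frechet_derivative f (at x) v) (g x)"])
      (use Suc.prems * in \<open>auto intro!: bounded_bilinear.FDERIV[OF assms(2)] times_cont_diff_on_add
        \<open>open S\<close> Suc.IH simp: frechet_derivative_works\<close>)
qed

lemma frechet_derivative_real_direction:
  fixes f :: "real \<Rightarrow> 'a::real_normed_vector"
  assumes "f differentiable (at x)"
  shows "frechet_derivative f (at x) v = v *\<^sub>R frechet_derivative f (at x) 1"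
  using linear_scale[OF linear_frechet_derivative[OF assms], of v 1] by simp

text \<open>For an outer function of one real variable the derivative of the composite is a scalar
  multiple of g'(f x), so the bilinear rule closes the induction. The induction replaces
  \<open>g\<close> by its derivative and only lowers the order of \<open>f\<close>.\<close>

lemma times_cont_diff_on_compose:
  fixes g :: "real \<Rightarrow> 'b::real_normed_vector"
  assumes "open S" "times_cont_diff_on k T g" "times_cont_diff_on k S f" "f ` S \<subseteq> T"
  shows "times_cont_diff_on k S (\<lambda>x. g (f x))"
  using assms(2,3)
proof (induction k arbitrary: g)
  case 0
  then show ?case using continuous_on_compose2[of T g S f] assms(4) by simp
next
  case (Suc k)
  have *: "times_cont_diff_on k S f"
    using Suc.prems by (blast intro: times_cont_diff_on_SucD)
  have d: "g differentiable (at (f x))" if "x \<in> S" for x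
    using Suc.prems(1) assms(4) that by auto
  show ?case
  proof (rule times_cont_diff_on_SucI[OF \<open>open S\<close>, where f' = "\<lambda>x v.
          frechet_derivative f (at x) v *\<^sub>R frechet_derivative g (at (f x)) 1"])
    fix x assume x: "x \<in> S"
    have "(g \<circ> f has_derivative frechet_derivative g (at (f x)) \<circ> frechet_derivative f (at x)) (at x)"
      using d[OF x] Suc.prems(2) x
      by (intro diff_chain_at) (simp_all add: frechet_derivative_works)
    moreover have "frechet_derivative g (at (f x)) \<circ> frechet_derivative f (at x) =
        (\<lambda>v. frechet_derivative f (at x) v *\<^sub>R frechet_derivative g (at (f x)) 1)"
      by (rule ext) (simp only: o_def, rule frechet_derivative_real_direction[OF d[OF x]])
    ultimately show "((\<lambda>x. g (f x)) has_derivative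
        (\<lambda>v. frechet_derivative f (at x) v *\<^sub>R frechet_derivative g (at (f x)) 1)) (at x)"
      by (simp add: o_def)
  next
    fix v
    show "times_cont_diff_on k S
        (\<lambda>x. frechet_derivative f (at x) v *\<^sub>R frechet_derivative g (at (f x)) 1)"
      using Suc.prems Suc.IH[of "\<lambda>y. frechet_derivative g (at y) 1"] *
      by (intro times_cont_diff_on_bilinear[OF \<open>open S\<close> bounded_bilinear_scaleR]) auto
  qed
qed

section \<open>Closure rules for smooth maps\<close>

lemma smooth_on_cong:
  assumes "open S" "\<And>x. x \<in> S \<Longrightarrow> f x = g x"
  shows "smooth_on S f \<longleftrightarrow> smooth_on S g"
  unfolding smooth_on_def using times_cont_diff_on_cong[OF assms] by simp

lemma smooth_on_differentiable: "smooth_on S f \<Longrightarrow> x \<in> S \<Longrightarrow> f differentiable (at x)"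
  using times_cont_diff_on.simps(2)[of 0 S f] by (simp add: smooth_on_def)

lemma smooth_on_has_derivative:
  "smooth_on S f \<Longrightarrow> x \<in> S \<Longrightarrow> (f has_derivative frechet_derivative f (at x)) (at x)"
  using smooth_on_differentiable frechet_derivative_works by blast

lemma smooth_on_frechet_derivative:
  "smooth_on S f \<Longrightarrow> smooth_on S (\<lambda>x. frechet_derivative f (at x) v)"
  by (metis smooth_on_def times_cont_diff_on.simps(2))

lemma smooth_on_continuous_on: "smooth_on S f \<Longrightarrow> continuous_on S f"
  by (metis smooth_on_def times_cont_diff_on.simps(1))

lemma smooth_on_const: "open S \<Longrightarrow> smooth_on S (\<lambda>x. c)"
  by (simp add: smooth_on_def times_cont_diff_on_const)

lemma smooth_on_add: "open S \<Longrightarrow> smooth_on S f \<Longrightarrow> smooth_on S g \<Longrightarrow> smooth_on S (\<lambda>x. f x + g x)"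
  by (simp add: smooth_on_def times_cont_diff_on_add)

lemma smooth_on_bounded_linear:
  "open S \<Longrightarrow> bounded_linear L \<Longrightarrow> smooth_on S f \<Longrightarrow> smooth_on S (\<lambda>x. L (f x))"
  by (simp add: smooth_on_def times_cont_diff_on_bounded_linear)

lemma smooth_on_minus: "open S \<Longrightarrow> smooth_on S f \<Longrightarrow> smooth_on S (\<lambda>x. - f x)"
  by (rule smooth_on_bounded_linear[OF _ bounded_linear_minus[OF bounded_linear_ident]])

lemma smooth_on_diff: "open S \<Longrightarrow> smooth_on S f \<Longrightarrow> smooth_on S g \<Longrightarrow> smooth_on S (\<lambda>x. f x - g x)"
  using smooth_on_add[of S f "\<lambda>x. - g x"] smooth_on_minus[of S g] by simp

lemma smooth_on_bilinear:
  "open S \<Longrightarrow> bounded_bilinear B \<Longrightarrow> smooth_on S f \<Longrightarrow> smooth_on S g \<Longrightarrow> smooth_on S (\<lambda>x. B (f x) (g x))"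
  by (simp add: smooth_on_def times_cont_diff_on_bilinear)

lemmas smooth_on_scaleR = smooth_on_bilinear[OF _ bounded_bilinear_scaleR]
lemmas smooth_on_inner = smooth_on_bilinear[OF _ bounded_bilinear_inner]
lemmas smooth_on_fst = smooth_on_bounded_linear[OF _ bounded_linear_fst]
lemmas smooth_on_snd = smooth_on_bounded_linear[OF _ bounded_linear_snd]

lemma smooth_on_mult:
  fixes f g :: "'a::euclidean_space \<Rightarrow> real"
  shows "open S \<Longrightarrow> smooth_on S f \<Longrightarrow> smooth_on S g \<Longrightarrow> smooth_on S (\<lambda>x. f x * g x)"
  by (rule smooth_on_bilinear[OF _ bounded_bilinear_mult])

lemma smooth_on_power:
  fixes f :: "'a::euclidean_space \<Rightarrow> real"
  shows "open S \<Longrightarrow> smooth_on S f \<Longrightarrow> smooth_on S (\<lambda>x. f x ^ m)"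
  by (induction m) (simp_all add: smooth_on_const smooth_on_mult)

lemma smooth_on_Pair:
  assumes "open S" "smooth_on S f" "smooth_on S g"
  shows "smooth_on S (\<lambda>x. (f x, g x))"
proof -
  have "smooth_on S (\<lambda>x. (f x, 0) + (0, g x))"
    using assms
    by (intro smooth_on_add[OF assms(1)] smooth_on_bounded_linear[of S "\<lambda>a. (a, 0)" f]
        smooth_on_bounded_linear[of S "\<lambda>a. (0, a)" g]
        bounded_linear_Pair bounded_linear_ident bounded_linear_zero)
  then show ?thesis by simp
qed

lemma smooth_on_compose:
  fixes g :: "real \<Rightarrow> 'b::real_normed_vector"
  shows "open S \<Longrightarrow> smooth_on T g \<Longrightarrow> smooth_on S f \<Longrightarrow> f ` S \<subseteq> T \<Longrightarrow> smooth_on S (\<lambda>x. g (f x))"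
  by (simp add: smooth_on_def times_cont_diff_on_compose[where T = T])

lemma smooth_on_subset:
  assumes "smooth_on T f" "S \<subseteq> T"
  shows "smooth_on S f"
proof -
  have "times_cont_diff_on k T f \<Longrightarrow> times_cont_diff_on k S f" for k
    by (induction k arbitrary: f) (use assms(2) in \<open>auto intro: continuous_on_subset\<close>)
  with assms(1) show ?thesis by (simp add: smooth_on_def)
qed

lemma smooth_on_ident: "open S \<Longrightarrow> smooth_on S (\<lambda>x. x)"
proof -
  assume S: "open S"
  have "times_cont_diff_on k S (\<lambda>x. x)" for k
    by (cases k) (auto simp: times_cont_diff_on_const[OF S])
  then show ?thesis by (simp add: smooth_on_def)
qed

text \<open>Induction on the order with \<open>P\<close> as invariant. It serves for families stable
  under differentiation: spans of sin and cos or of cosh and sinh, multiples of real powers,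
  everywhere convergent power series.\<close>

lemma smooth_on_derivative_closed:
  fixes f :: "real \<Rightarrow> real"
  assumes "open S" "P f"
    and step: "\<And>f. P f \<Longrightarrow> \<exists>f'. P f' \<and> (\<forall>x\<in>S. (f has_real_derivative f' x) (at x))"
  shows "smooth_on S f"
proof -
  have "times_cont_diff_on k S f" if "P f" for k f
    using that
  proof (induction k arbitrary: f)
    case 0
    from step[OF 0] show ?case
      by (auto intro!: continuous_at_imp_continuous_on intro: DERIV_isCont)
  next
    case (Suc k)
    from step[OF Suc.prems] obtain f'
      where f': "P f'" "\<And>x. x \<in> S \<Longrightarrow> (f has_real_derivative f' x) (at x)" by blast
    show ?case
    proof (rule times_cont_diff_on_SucI[OF \<open>open S\<close>, where f' = "\<lambda>x v. f' x * v"])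
      show "(f has_derivative (*) (f' x)) (at x)" if "x \<in> S" for x
        using f'(2)[OF that] by (simp add: has_field_derivative_def)
      show "times_cont_diff_on k S (\<lambda>x. f' x * v)" for v
        by (rule times_cont_diff_on_bounded_linear[OF \<open>open S\<close> bounded_linear_mult_left])
          (rule Suc.IH[OF f'(1)])
    qed
  qed
  with assms(2) show ?thesis by (simp add: smooth_on_def)
qed

section \<open>Smoothness of elementary functions and power series\<close>

lemma smooth_on_sin_cos: "smooth_on UNIV (\<lambda>x::real. a * sin x + b * cos x)"
proof (rule smooth_on_derivative_closed[where P = "\<lambda>f. \<exists>a b. f = (\<lambda>x. a * sin x + b * cos x)"])
  fix f :: "real \<Rightarrow> real"
  assume "\<exists>a b. f = (\<lambda>x. a * sin x + b * cos x)"
  then obtain a b where f: "f = (\<lambda>x. a * sin x + b * cos x)" by blast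
  have "\<forall>x\<in>UNIV. (f has_real_derivative (- b) * sin x + a * cos x) (at x)"
    unfolding f by (auto intro!: derivative_eq_intros)
  then show "\<exists>f'. (\<exists>a b. f' = (\<lambda>x. a * sin x + b * cos x)) \<and>
      (\<forall>x\<in>UNIV. (f has_real_derivative f' x) (at x))"
    by blast
qed auto

lemma smooth_on_cosh_sinh: "smooth_on UNIV (\<lambda>x::real. a * cosh x + b * sinh x)"
proof (rule smooth_on_derivative_closed[where P = "\<lambda>f. \<exists>a b. f = (\<lambda>x. a * cosh x + b * sinh x)"])
  fix f :: "real \<Rightarrow> real"
  assume "\<exists>a b. f = (\<lambda>x. a * cosh x + b * sinh x)"
  then obtain a b where f: "f = (\<lambda>x. a * cosh x + b * sinh x)" by blast
  have "\<forall>x\<in>UNIV. (f has_real_derivative b * cosh x + a * sinh x) (at x)"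
    unfolding f by (auto intro!: derivative_eq_intros)
  then show "\<exists>f'. (\<exists>a b. f' = (\<lambda>x. a * cosh x + b * sinh x)) \<and>
      (\<forall>x\<in>UNIV. (f has_real_derivative f' x) (at x))"
    by blast
qed auto

lemma smooth_on_powr: "smooth_on {0<..} (\<lambda>x::real. x powr a)"
proof -
  have "smooth_on {0<..} (\<lambda>x::real. 1 * x powr a)"
  proof (rule smooth_on_derivative_closed[where P = "\<lambda>f. \<exists>c a. f = (\<lambda>x. c * x powr a)"])
    fix f :: "real \<Rightarrow> real"
    assume "\<exists>c a. f = (\<lambda>x. c * x powr a)"
    then obtain c a where f: "f = (\<lambda>x. c * x powr a)" by blast
    have "\<forall>x\<in>{0<..}. (f has_real_derivative (c * a) * x powr (a - 1)) (at x)"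
      unfolding f by (auto intro!: derivative_eq_intros)
    then show "\<exists>f'. (\<exists>c a. f' = (\<lambda>x. c * x powr a)) \<and>
        (\<forall>x\<in>{0<..}. (f has_real_derivative f' x) (at x))"
      by blast
  qed (simp, blast)
  then show ?thesis by simp
qed

lemma smooth_on_inverse: "smooth_on {0<..} (inverse :: real \<Rightarrow> real)"
  using smooth_on_powr[of "-1"]
    smooth_on_cong[of "{0<..}" "\<lambda>x. x powr -1" "inverse :: real \<Rightarrow> real"]
  by (simp add: powr_minus)

lemma smooth_on_sqrt: "smooth_on {0<..} sqrt"
  using smooth_on_powr[of "1/2"] smooth_on_cong[of "{0<..}" "\<lambda>x. x powr (1/2)" sqrt]
  by (simp add: powr_half_sqrt)

lemma smooth_on_ln: "smooth_on {0<..} (ln :: real \<Rightarrow> real)"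
proof -
  have "times_cont_diff_on k {0<..} (ln :: real \<Rightarrow> real)" for k
  proof (cases k)
    case 0
    then show ?thesis by (auto intro!: continuous_intros)
  next
    case (Suc k')
    show ?thesis
      unfolding Suc
    proof (rule times_cont_diff_on_SucI[where f' = "\<lambda>x v. inverse x * v"])
      show "times_cont_diff_on k' {0<..} (\<lambda>x::real. inverse x * v)" for v
        using times_cont_diff_on_bounded_linear[OF _ bounded_linear_mult_left, of _ k' inverse v]
          smooth_on_inverse by (simp add: smooth_on_def)
      show "(ln has_derivative (*) (inverse x)) (at x)" if "x \<in> {0<..}" for x :: real
        using DERIV_ln[of x] that by (simp add: has_field_derivative_def)
    qed simp
  qed
  then show ?thesis by (simp add: smooth_on_def)
qed

text \<open>Termwise differentiation replaces \<open>c\<close> by \<open>diffs c\<close> and keeps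
  convergence on the whole line. Evaluated at r^2, such series give the coefficients of a metric
  that stays smooth at r = 0.\<close>

lemma smooth_on_powser:
  fixes c :: "nat \<Rightarrow> real"
  assumes "\<And>x. summable (\<lambda>n. c n * x ^ n)"
  shows "smooth_on UNIV (\<lambda>x. \<Sum>n. c n * x ^ n)"
proof (rule smooth_on_derivative_closed[where
      P = "\<lambda>f. \<exists>c. (\<forall>x. summable (\<lambda>n. c n * x ^ n)) \<and> f = (\<lambda>x. \<Sum>n. c n * x ^ n)"])
  show "\<exists>d. (\<forall>x. summable (\<lambda>n. d n * x ^ n)) \<and>
      (\<lambda>x. \<Sum>n. c n * x ^ n) = (\<lambda>x. \<Sum>n. d n * x ^ n)"
    using assms by blast
next
  fix f :: "real \<Rightarrow> real"
  assume "\<exists>c. (\<forall>x. summable (\<lambda>n. c n * x ^ n)) \<and> f = (\<lambda>x. \<Sum>n. c n * x ^ n)"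
  then obtain c where c: "\<And>x. summable (\<lambda>n. c n * x ^ n)" and f: "f = (\<lambda>x. \<Sum>n. c n * x ^ n)"
    by blast
  have "(f has_real_derivative (\<Sum>n. diffs c n * x ^ n)) (at x)" for x
    unfolding f by (rule termdiffs_strong_converges_everywhere) (rule c)
  moreover have "summable (\<lambda>n. diffs c n * x ^ n)" for x
    by (rule termdiff_converges_all) (rule c)
  ultimately show "\<exists>f'. (\<exists>c. (\<forall>x. summable (\<lambda>n. c n * x ^ n)) \<and> f' = (\<lambda>x. \<Sum>n. c n * x ^ n)) \<and>
      (\<forall>x\<in>UNIV. (f has_real_derivative f' x) (at x))"
    by blast
qed simp

lemma smooth_on_divide:
  fixes f g :: "'a::euclidean_space \<Rightarrow> real"
  assumes "open S" "smooth_on S f" "smooth_on S g" "\<And>x. x \<in> S \<Longrightarrow> g x > 0"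
  shows "smooth_on S (\<lambda>x. f x / g x)"
  unfolding divide_inverse
  by (intro smooth_on_mult smooth_on_compose[OF _ smooth_on_inverse] assms) (use assms(4) in auto)


section \<open>Symmetry of second derivatives\<close>

lemma smooth_on_line_derivative:
  fixes F :: "'a::euclidean_space \<Rightarrow> real"
  assumes "smooth_on U F" "y + t *\<^sub>R v \<in> U"
  shows "((\<lambda>t. F (y + t *\<^sub>R v)) has_real_derivative frechet_derivative F (at (y + t *\<^sub>R v)) v) (at t)"
proof -
  have F: "(F has_derivative frechet_derivative F (at (y + t *\<^sub>R v))) (at (y + t *\<^sub>R v))"
    using smooth_on_has_derivative[OF assms] .
  have "((\<lambda>t. y + t *\<^sub>R v) has_derivative (\<lambda>h. h *\<^sub>R v)) (at t)"
    by (auto intro!: derivative_eq_intros)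
  from has_derivative_compose[OF this F]
  show ?thesis
    unfolding has_field_derivative_def
    using linear_scale[OF has_derivative_linear[OF F]] by (simp add: mult.commute[of _ "frechet_derivative _ _ _"])
qed

text \<open>The mean value theorem is applied twice: in direction \<open>v\<close> to the increment
  of \<open>F\<close> under the shift by \<open>s *\<^sub>R w\<close>, then in direction
  \<open>w\<close> to the derivative along \<open>v\<close>. The left side is symmetric in
  \<open>v\<close> and \<open>w\<close> while the order of differentiation on the right is not,
  which is the source of Schwarz's theorem.\<close>

lemma second_difference_mean_value:
  fixes F :: "'a::euclidean_space \<Rightarrow> real"
  assumes F: "smooth_on U F" and "s > 0"
    and U: "\<And>a b. a \<in> {0..s} \<Longrightarrow> b \<in> {0..s} \<Longrightarrow> x + a *\<^sub>R v + b *\<^sub>R w \<in> U"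
  shows "\<exists>a\<in>{0..s}. \<exists>b\<in>{0..s}.
    F (x + s *\<^sub>R v + s *\<^sub>R w) - F (x + s *\<^sub>R v) - F (x + s *\<^sub>R w) + F x =
    s * s * frechet_derivative (\<lambda>y. frechet_derivative F (at y) v) (at (x + a *\<^sub>R v + b *\<^sub>R w)) w"
proof -
  let ?Fv = "\<lambda>y. frechet_derivative F (at y) v"
  have Fv: "smooth_on U ?Fv"
    using F by (rule smooth_on_frechet_derivative)
  have "\<exists>a>0. a < s \<and> (F (x + s *\<^sub>R w + s *\<^sub>R v) - F (x + s *\<^sub>R v)) -
      (F (x + s *\<^sub>R w + 0 *\<^sub>R v) - F (x + 0 *\<^sub>R v)) =
      (s - 0) * (?Fv (x + s *\<^sub>R w + a *\<^sub>R v) - ?Fv (x + a *\<^sub>R v))"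
  proof (rule MVT2[OF \<open>s > 0\<close>])
    fix a assume a: "0 \<le> a" "a \<le> s"
    have "x + s *\<^sub>R w + a *\<^sub>R v \<in> U" "x + a *\<^sub>R v \<in> U"
      using U[of a s] U[of a 0] a \<open>s > 0\<close> by (auto simp: algebra_simps)
    then show "((\<lambda>a. F (x + s *\<^sub>R w + a *\<^sub>R v) - F (x + a *\<^sub>R v)) has_real_derivative
        ?Fv (x + s *\<^sub>R w + a *\<^sub>R v) - ?Fv (x + a *\<^sub>R v)) (at a)"
      by (intro DERIV_diff smooth_on_line_derivative[OF F])
  qed
  then obtain a where a: "0 < a" "a < s"
    and eq: "F (x + s *\<^sub>R v + s *\<^sub>R w) - F (x + s *\<^sub>R v) - F (x + s *\<^sub>R w) + F x =
      s * (?Fv (x + a *\<^sub>R v + s *\<^sub>R w) - ?Fv (x + a *\<^sub>R v))"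
    by (auto simp: algebra_simps)
  have "\<exists>b>0. b < s \<and> ?Fv (x + a *\<^sub>R v + s *\<^sub>R w) - ?Fv (x + a *\<^sub>R v + 0 *\<^sub>R w) =
      (s - 0) * frechet_derivative ?Fv (at (x + a *\<^sub>R v + b *\<^sub>R w)) w"
    by (rule MVT2[OF \<open>s > 0\<close>], rule smooth_on_line_derivative[OF Fv], rule U) (use a in auto)
  then obtain b where "0 < b" "b < s" "?Fv (x + a *\<^sub>R v + s *\<^sub>R w) - ?Fv (x + a *\<^sub>R v) =
      s * frechet_derivative ?Fv (at (x + a *\<^sub>R v + b *\<^sub>R w)) w"
    by auto
  with eq a show ?thesis
    by (intro bexI[of _ a] bexI[of _ b]) auto
qed

lemma frechet_derivative_symmetric_real:
  fixes F :: "'a::euclidean_space \<Rightarrow> real"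
  assumes "open U" "smooth_on U F" "x \<in> U"
  shows "frechet_derivative (\<lambda>y. frechet_derivative F (at y) v) (at x) w =
    frechet_derivative (\<lambda>y. frechet_derivative F (at y) w) (at x) v"
proof (rule ccontr)
  define A where "A y = frechet_derivative (\<lambda>y. frechet_derivative F (at y) v) (at y) w" for y
  define B where "B y = frechet_derivative (\<lambda>y. frechet_derivative F (at y) w) (at y) v" for y
  assume "\<not> ?thesis"
  \<comment> \<open>Half the gap between the mixed derivatives: a value this close to
    \<open>A x\<close> cannot equal one this close to \<open>B x\<close>.\<close>
  then have e: "\<bar>A x - B x\<bar> / 2 > 0" (is "?e > 0") by (simp add: A_def B_def)
  have "continuous_on U A" "continuous_on U B"
    unfolding A_def B_def using assms(2)
    by (auto intro!: smooth_on_continuous_on smooth_on_frechet_derivative)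
  then have "isCont A x" "isCont B x"
    using assms by (auto simp: continuous_on_eq_continuous_at)
  then obtain d1 d2 where d: "d1 > 0" "\<And>y. dist y x < d1 \<Longrightarrow> dist (A y) (A x) < ?e"
    "d2 > 0" "\<And>y. dist y x < d2 \<Longrightarrow> dist (B y) (B x) < ?e"
    using e unfolding continuous_at_eps_delta dist_norm by metis
  obtain d3 where d3: "d3 > 0" "ball x d3 \<subseteq> U"
    using assms openE by blast
  define d where "d = min d1 (min d2 d3)"
  \<comment> \<open>The summand 1 keeps \<open>m\<close> positive even if both directions vanish;
    the factor 2 in \<open>s\<close> puts the parallelogram strictly inside radius
    \<open>d\<close>.\<close>
  define m where "m = norm v + norm w + 1"
  define s where "s = d / (2 * m)"
  have "d > 0" using d d3 by (simp add: d_def)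
  have pos: "m > 0" unfolding m_def by (smt (verit) norm_ge_zero)
  have s: "s > 0" unfolding s_def using \<open>d > 0\<close> pos by simp
  have near: "dist (x + a *\<^sub>R v + b *\<^sub>R w) x < d" if "a \<in> {0..s}" "b \<in> {0..s}" for a b
  proof -
    have "norm (a *\<^sub>R v + b *\<^sub>R w) \<le> a * norm v + b * norm w"
      using that norm_triangle_ineq[of "a *\<^sub>R v" "b *\<^sub>R w"] by simp
    also have "\<dots> \<le> s * norm v + s * norm w"
      using that by (intro add_mono mult_right_mono) auto
    also have "\<dots> \<le> s * m"
      using s by (simp add: m_def algebra_simps)
    also have "\<dots> = d / 2" unfolding s_def using pos by simp
    also have "\<dots> < d" using \<open>d > 0\<close> by simp
    finally show ?thesis by (simp add: dist_norm add.assoc)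
  qed
  have inU: "x + a *\<^sub>R v + b *\<^sub>R w \<in> U" if "a \<in> {0..s}" "b \<in> {0..s}" for a b
    using near[OF that] d3 by (auto simp: d_def dist_commute)
  have inU': "x + a *\<^sub>R w + b *\<^sub>R v \<in> U" if "a \<in> {0..s}" "b \<in> {0..s}" for a b
    using inU[of b a] that by (simp add: algebra_simps)
  from second_difference_mean_value[OF assms(2) s inU] obtain a b
    where ab: "a \<in> {0..s}" "b \<in> {0..s}" and 1: "F (x + s *\<^sub>R v + s *\<^sub>R w) - F (x + s *\<^sub>R v) - F (x + s *\<^sub>R w) + F x =
      s * s * A (x + a *\<^sub>R v + b *\<^sub>R w)"
    unfolding A_def by blast
  from second_difference_mean_value[OF assms(2) s inU'] obtain a' b'
    where ab': "a' \<in> {0..s}" "b' \<in> {0..s}" and 2: "F (x + s *\<^sub>R w + s *\<^sub>R v) - F (x + s *\<^sub>R w) - F (x + s *\<^sub>R v) + F x =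
      s * s * B (x + a' *\<^sub>R w + b' *\<^sub>R v)"
    unfolding B_def by blast
  \<comment> \<open>Both sides are the same second difference divided by s^2.\<close>
  have "A (x + a *\<^sub>R v + b *\<^sub>R w) = B (x + b' *\<^sub>R v + a' *\<^sub>R w)"
    using 1 2 s by (simp add: algebra_simps)
  moreover have "dist (A (x + a *\<^sub>R v + b *\<^sub>R w)) (A x) < ?e"
    using near[OF ab] by (intro d) (simp add: d_def)
  moreover have "dist (B (x + b' *\<^sub>R v + a' *\<^sub>R w)) (B x) < ?e"
    using near[OF ab'(2,1)] by (intro d) (simp add: d_def)
  ultimately show False
    unfolding dist_real_def by argo
qed

text \<open>Testing against basis vectors reduces this to the real-valued case.\<close>

lemma frechet_derivative_symmetric:
  fixes F :: "'a::euclidean_space \<Rightarrow> 'b::euclidean_space"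
  assumes "open U" "smooth_on U F" "x \<in> U"
  shows "frechet_derivative (\<lambda>y. frechet_derivative F (at y) v) (at x) w =
    frechet_derivative (\<lambda>y. frechet_derivative F (at y) w) (at x) v"
proof (rule euclidean_eqI)
  fix b :: 'b
  have inner: "frechet_derivative (\<lambda>y. f y \<bullet> b) (at y) z = frechet_derivative f (at y) z \<bullet> b"
    if "smooth_on U f" "y \<in> U" for y z and f :: "'a \<Rightarrow> 'b"
    using has_derivative_inner_left[OF smooth_on_has_derivative[OF that], of b]
    by (simp add: frechet_derivative_at[symmetric])
  let ?G = "\<lambda>y. F y \<bullet> b"
  have G: "smooth_on U ?G"
    using assms(1,2) by (intro smooth_on_inner smooth_on_const)
  have "frechet_derivative (\<lambda>y. frechet_derivative ?G (at y) p) (at x) q =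
      frechet_derivative (\<lambda>y. frechet_derivative F (at y) p) (at x) q \<bullet> b" for p q
  proof -
    have "frechet_derivative (\<lambda>y. frechet_derivative ?G (at y) p) (at x) =
        frechet_derivative (\<lambda>y. frechet_derivative F (at y) p \<bullet> b) (at x)"
      using smooth_on_differentiable[OF smooth_on_frechet_derivative[OF G]] inner[OF assms(2)] assms
      by (intro frechet_derivative_transform_within_open[of _ _ U]) auto
    then show ?thesis
      using inner[OF smooth_on_frechet_derivative[OF assms(2)] assms(3)] by simp
  qed
  then show "frechet_derivative (\<lambda>y. frechet_derivative F (at y) v) (at x) w \<bullet> b =
    frechet_derivative (\<lambda>y. frechet_derivative F (at y) w) (at x) v \<bullet> b"
    using frechet_derivative_symmetric_real[OF assms(1) G assms(3), of v w] by simp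
qed

section \<open>Partial derivatives\<close>

text \<open>This is \<open>pd\<close> for values in any normed space, so that the real radius and
  the vector-valued angle are differentiated by the same rules.\<close>

definition partial :: "'n::finite \<Rightarrow> (real^'n \<Rightarrow> 'b::real_normed_vector) \<Rightarrow> real^'n \<Rightarrow> 'b" where
  "partial i F u = frechet_derivative F (at u) (axis i 1)"

lemma pd_eq_partial: "pd i F u = partial i F u"
  by (simp add: pd_def partial_def)

lemma partial_eqI: "(F has_derivative F') (at u) \<Longrightarrow> partial i F u = F' (axis i 1)"
  unfolding partial_def using frechet_derivative_at by metis

lemma partial_cong:
  assumes "open U" "u \<in> U" "F differentiable (at u)" "\<And>x. x \<in> U \<Longrightarrow> F x = F2 x"
  shows "partial i F u = partial i F2 u"
  unfolding partial_def
  using frechet_derivative_transform_within_open[OF assms(3,1,2), of F2] assms(4) by simp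

lemma partial_smooth: "smooth_on U F \<Longrightarrow> smooth_on U (partial i F)"
  unfolding partial_def by (rule smooth_on_frechet_derivative)

lemma partial_symmetric:
  fixes F :: "real^'n::finite \<Rightarrow> 'b::euclidean_space"
  assumes "open U" "smooth_on U F" "u \<in> U"
  shows "partial i (partial j F) u = partial j (partial i F) u"
  using frechet_derivative_symmetric[OF assms] unfolding partial_def by blast

lemma partial_add:
  "F differentiable (at u) \<Longrightarrow> H differentiable (at u) \<Longrightarrow>
    partial i (\<lambda>x. F x + H x) u = partial i F u + partial i H u"
  unfolding partial_def[of i F] partial_def[of i H] frechet_derivative_works
  by (rule partial_eqI) (rule has_derivative_add)

lemma partial_diff:
  "F differentiable (at u) \<Longrightarrow> H differentiable (at u) \<Longrightarrow>
    partial i (\<lambda>x. F x - H x) u = partial i F u - partial i H u"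
  unfolding partial_def[of i F] partial_def[of i H] frechet_derivative_works
  by (rule partial_eqI) (rule has_derivative_diff)

lemma partial_scaleR:
  "F differentiable (at u) \<Longrightarrow> H differentiable (at u) \<Longrightarrow>
    partial i (\<lambda>x. F x *\<^sub>R H x) u = F u *\<^sub>R partial i H u + partial i F u *\<^sub>R H u"
  unfolding partial_def[of i F] partial_def[of i H] frechet_derivative_works
  by (rule partial_eqI) (rule has_derivative_scaleR)

lemma partial_mult:
  fixes F H :: "real^'n::finite \<Rightarrow> real"
  shows "F differentiable (at u) \<Longrightarrow> H differentiable (at u) \<Longrightarrow>
    partial i (\<lambda>x. F x * H x) u = F u * partial i H u + partial i F u * H u"
  unfolding partial_def[of i F] partial_def[of i H] frechet_derivative_works
  by (rule partial_eqI) (rule has_derivative_mult)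

lemma partial_inner:
  fixes F H :: "real^'n::finite \<Rightarrow> 'b::real_inner"
  shows "F differentiable (at u) \<Longrightarrow> H differentiable (at u) \<Longrightarrow>
    partial i (\<lambda>x. F x \<bullet> H x) u = F u \<bullet> partial i H u + partial i F u \<bullet> H u"
  unfolding partial_def[of i F] partial_def[of i H] frechet_derivative_works
  by (rule partial_eqI) (rule has_derivative_inner)

lemma partial_sum:
  "(\<And>k. k \<in> K \<Longrightarrow> F k differentiable (at u)) \<Longrightarrow>
    partial i (\<lambda>x. \<Sum>k\<in>K. F k x) u = (\<Sum>k\<in>K. partial i (F k) u)"
  unfolding partial_def[of i "F _"] frechet_derivative_works
  by (rule partial_eqI) (rule has_derivative_sum)

lemma partial_compose:
  fixes F :: "real^'n::finite \<Rightarrow> real"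
  assumes "F differentiable (at u)" "(f has_real_derivative f') (at (F u))"
  shows "partial i (\<lambda>x. f (F x)) u = f' * partial i F u"
  using partial_eqI[OF has_derivative_compose[OF assms(1)[unfolded frechet_derivative_works]
        assms(2)[unfolded has_field_derivative_def]], of i]
  by (simp add: partial_def)

lemma real_derivative_compose_differentiable:
  "F differentiable (at u) \<Longrightarrow> (f has_real_derivative f') (at (F u)) \<Longrightarrow>
    (\<lambda>x. f (F x)) differentiable (at u)"
  unfolding differentiable_def has_field_derivative_def using has_derivative_compose by blast

section \<open>Linear algebra: coordinates, determinants and matrix inverses\<close>

lemma linear_axis_expansion:
  fixes L :: "real^'n::finite \<Rightarrow> 'b::real_vector"
  assumes "linear L"
  shows "L v = (\<Sum>k\<in>UNIV. v $ k *\<^sub>R L (axis k 1))"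
proof -
  have "L v = L (\<Sum>k\<in>UNIV. v $ k *\<^sub>R axis k 1)"
    using basis_expansion[of v] by (simp add: scalar_mult_eq_scaleR)
  then show ?thesis
    by (simp add: linear_sum[OF assms] linear_scale[OF assms])
qed

lemma prod_differentiable:
  fixes F :: "'i \<Rightarrow> 'a::real_normed_vector \<Rightarrow> real"
  assumes "\<And>i. i \<in> K \<Longrightarrow> F i differentiable (at u)"
  shows "(\<lambda>x. \<Prod>i\<in>K. F i x) differentiable (at u)"
  by (rule differentiableI, rule has_derivative_prod) (rule assms[unfolded frechet_derivative_works])

lemma det_differentiable:
  fixes A :: "'a::real_normed_vector \<Rightarrow> real^'n::finite^'n"
  assumes "\<And>i j. (\<lambda>x. A x $ i $ j) differentiable (at u)"
  shows "(\<lambda>x. det (A x)) differentiable (at u)"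
  unfolding det_def
  by (intro differentiable_sum ballI differentiable_mult differentiable_const prod_differentiable assms)
    simp

lemma matrix_inv_left: "invertible A \<Longrightarrow> matrix_inv A ** A = mat 1"
  and matrix_inv_right: "invertible A \<Longrightarrow> A ** matrix_inv A = mat 1"
  unfolding matrix_inv_def invertible_def by (metis (mono_tags, lifting) someI_ex)+

text \<open>By Cramer's rule the entry is a quotient of determinants, with column \<open>k\<close>
  replaced by the \<open>l\<close>-th unit vector in the numerator. Applied to the metric, this
  makes the Christoffel symbols differentiable.\<close>

lemma matrix_inv_entry_differentiable:
  fixes A :: "'a::real_normed_vector \<Rightarrow> real^'n::finite^'n"
  assumes "open U" "u \<in> U" "\<And>x. x \<in> U \<Longrightarrow> invertible (A x)"
    and A: "\<And>i j. (\<lambda>x. A x $ i $ j) differentiable (at u)"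
  shows "(\<lambda>x. matrix_inv (A x) $ k $ l) differentiable (at u)"
proof -
  define N where "N x = det (\<chi> i j. if j = k then axis l 1 $ i else A x $ i $ j)" for x
  have eq: "N x / det (A x) = matrix_inv (A x) $ k $ l" if "x \<in> U" for x
  proof -
    have "A x *v (matrix_inv (A x) *v axis l 1) = axis l 1"
      using matrix_inv_right[OF assms(3)[OF that]] by (simp add: matrix_vector_mul_assoc)
    then have "matrix_inv (A x) *v axis l 1 =
        (\<chi> k. det (\<chi> i j. if j = k then axis l 1 $ i else A x $ i $ j) / det (A x))"
      using cramer[of "A x" _ "axis l 1"] assms(3)[OF that] invertible_det_nz by blast
    then have "(matrix_inv (A x) *v axis l 1) $ k = N x / det (A x)"
      by (simp add: N_def)
    then show ?thesis
      by (simp add: matrix_vector_mul_component column_def matrix_vector_mult_basis)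
  qed
  have "N differentiable (at u)"
    unfolding N_def
  proof (rule det_differentiable)
    fix i j
    show "(\<lambda>x. (\<chi> i j. if j = k then axis l 1 $ i else A x $ i $ j) $ i $ j) differentiable (at u)"
      by (cases "j = k") (simp_all add: A)
  qed
  moreover have "det (A u) \<noteq> 0"
    using assms(2,3) invertible_det_nz by blast
  ultimately have "(\<lambda>x. N x / det (A x)) differentiable (at u)"
    by (intro differentiable_divide det_differentiable A)
  then show ?thesis
    using eq has_derivative_transform_within_open[OF _ assms(1,2), of "\<lambda>x. N x / det (A x)" _ UNIV
        "\<lambda>x. matrix_inv (A x) $ k $ l"]
    unfolding differentiable_def by blast
qed

lemma independent_pair_coeffs:
  fixes v w :: "'a::real_vector"
  assumes "independent {v, w}" "v \<noteq> w" "a *\<^sub>R v = b *\<^sub>R w"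
  shows "a = 0 \<and> b = 0"
proof -
  define c where "c = (\<lambda>x. if x = v then a else - b)"
  have "(\<Sum>x\<in>{v, w}. c x *\<^sub>R x) = 0"
    using assms(2,3) by (simp add: c_def)
  then have "c v = 0" "c w = 0"
    using independentD[OF assms(1), of "{v, w}" c] by auto
  then show ?thesis using assms(2) by (simp add: c_def)
qed

section \<open>Curvature of a warped metric in an arbitrary chart\<close>

text \<open>The warping function stays general: \<open>h'\<close> and \<open>h''\<close> are
  parameters tied to \<open>h\<close> by derivative assumptions, so the curvature formulas can be
  stated in closed form.\<close>

locale warped_chart =
  fixes U :: "(real^'n::finite) set" and \<phi> :: "real^'n \<Rightarrow> real \<times> (real^'n)"
    and I :: "real set" and h h' h'' :: "real \<Rightarrow> real"
  assumes open_U: "open U"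
    and smooth_phi: "smooth_on U \<phi>"
    and inj_phi: "u \<in> U \<Longrightarrow> inj (frechet_derivative \<phi> (at u))"
    and phi_image: "\<phi> ` U \<subseteq> I \<times> sphere 0 1"
    and smooth_h: "smooth_on I h"
    and h_pos: "t \<in> I \<Longrightarrow> h t > 0"
    and h_deriv: "t \<in> I \<Longrightarrow> (h has_real_derivative h' t) (at t)"
    and h'_deriv: "t \<in> I \<Longrightarrow> (h' has_real_derivative h'' t) (at t)"
begin

definition "rad u = fst (\<phi> u)"
definition "ang u = snd (\<phi> u)"
definition "rad1 i = partial i rad"
definition "ang1 i = partial i ang"
definition "rad2 i j = partial i (rad1 j)"
definition "ang2 i j = partial i (ang1 j)"
text \<open>The components of the round metric of the sphere pulled back to the chart. As a form on
  chart vectors it is degenerate, with the radial direction as kernel.\<close>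

definition "sph u i j = ang1 i u \<bullet> ang1 j u"

abbreviation "G \<equiv> metric_matrix \<phi> (warped_metric h)"

abbreviation "\<Gamma> u k i j \<equiv> christoffel G u k i j"

lemma smooth_rad: "smooth_on U rad"
  unfolding rad_def by (rule smooth_on_fst[OF open_U smooth_phi])

lemma smooth_ang: "smooth_on U ang"
  unfolding ang_def by (rule smooth_on_snd[OF open_U smooth_phi])

lemma smooth_rad1: "smooth_on U (rad1 i)"
  unfolding rad1_def by (rule partial_smooth[OF smooth_rad])

lemma smooth_ang1: "smooth_on U (ang1 i)"
  unfolding ang1_def by (rule partial_smooth[OF smooth_ang])

lemma smooth_rad2: "smooth_on U (rad2 i j)"
  unfolding rad2_def by (rule partial_smooth[OF smooth_rad1])

lemma smooth_ang2: "smooth_on U (ang2 i j)"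
  unfolding ang2_def by (rule partial_smooth[OF smooth_ang1])

lemma rad_in_I: "u \<in> U \<Longrightarrow> rad u \<in> I"
  using phi_image by (auto simp: rad_def mem_Times_iff)

lemma ang_unit: "u \<in> U \<Longrightarrow> ang u \<bullet> ang u = 1"
  using phi_image by (auto simp: ang_def mem_Times_iff dot_square_norm)

lemmas diff_rad = smooth_on_differentiable[OF smooth_rad]
lemmas diff_ang = smooth_on_differentiable[OF smooth_ang]
lemmas diff_rad1 = smooth_on_differentiable[OF smooth_rad1]
lemmas diff_ang1 = smooth_on_differentiable[OF smooth_ang1]
lemmas diff_rad2 = smooth_on_differentiable[OF smooth_rad2]
lemmas diff_ang2 = smooth_on_differentiable[OF smooth_ang2]

lemma linear_dphi: "u \<in> U \<Longrightarrow> linear (frechet_derivative \<phi> (at u))"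
  by (rule linear_frechet_derivative[OF smooth_on_differentiable[OF smooth_phi]])

lemma dphi_axis:
  assumes "u \<in> U"
  shows "frechet_derivative \<phi> (at u) (axis i 1) = (rad1 i u, ang1 i u)"
proof -
  note d = smooth_on_has_derivative[OF smooth_phi assms]
  show ?thesis
    using partial_eqI[OF has_derivative_fst[OF d], of i] partial_eqI[OF has_derivative_snd[OF d], of i]
    by (simp add: rad1_def ang1_def rad_def[abs_def] ang_def[abs_def])
qed

lemma dphi_eq:
  assumes "u \<in> U"
  shows "frechet_derivative \<phi> (at u) v =
    (\<Sum>k\<in>UNIV. v $ k * rad1 k u, \<Sum>k\<in>UNIV. v $ k *\<^sub>R ang1 k u)"
  unfolding linear_axis_expansion[OF linear_dphi[OF assms], of v] dphi_axis[OF assms]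
  by (simp add: sum_prod)

lemma rad2_symmetric: "u \<in> U \<Longrightarrow> rad2 i j u = rad2 j i u"
  unfolding rad2_def rad1_def by (rule partial_symmetric[OF open_U smooth_rad])

lemma ang2_symmetric: "u \<in> U \<Longrightarrow> ang2 i j u = ang2 j i u"
  unfolding ang2_def ang1_def by (rule partial_symmetric[OF open_U smooth_ang])

lemma sph_symmetric: "sph u i j = sph u j i"
  by (simp add: sph_def inner_commute)

lemma ang1_ang:
  assumes "u \<in> U"
  shows "ang1 i u \<bullet> ang u = 0"
proof -
  have "partial i (\<lambda>x. ang x \<bullet> ang x) u = 0"
    using partial_cong[OF open_U assms, of "\<lambda>x. 1::real" "\<lambda>x. ang x \<bullet> ang x" i] ang_unit
    by (simp add: partial_def)
  then show ?thesis
    using partial_inner[OF diff_ang[OF assms] diff_ang[OF assms], of i]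
    by (simp add: ang1_def inner_commute)
qed

text \<open>Obtained by differentiating the orthogonality of \<open>ang1 j\<close> and
  \<open>ang\<close>; this normal component is the second fundamental form of the unit
  sphere.\<close>

lemma ang2_ang:
  assumes "u \<in> U"
  shows "ang2 i j u \<bullet> ang u = - sph u i j"
proof -
  have "partial i (\<lambda>x. ang1 j x \<bullet> ang x) u = 0"
    using partial_cong[OF open_U assms, of "\<lambda>x. 0::real" "\<lambda>x. ang1 j x \<bullet> ang x" i] ang1_ang
    by (simp add: partial_def)
  then show ?thesis
    using partial_inner[OF diff_ang1[OF assms] diff_ang[OF assms], of i j]
    by (simp add: ang2_def ang1_def sph_def inner_commute)
qed

lemma G_eq:
  assumes "u \<in> U"
  shows "G u $ i $ j = rad1 i u * rad1 j u + (h (rad u))\<^sup>2 * sph u i j"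
  by (simp add: metric_matrix_def pullback_def warped_metric_def dphi_axis[OF assms] rad_def sph_def)

lemma G_symmetric: "u \<in> U \<Longrightarrow> G u $ i $ j = G u $ j $ i"
  by (simp add: G_eq sph_symmetric[of u i j] mult.commute)

lemma metric_inner_eq:
  assumes "u \<in> U"
  shows "metric_inner G u v w =
    warped_metric h (\<phi> u) (frechet_derivative \<phi> (at u) v) (frechet_derivative \<phi> (at u) w)"
proof -
  have "(\<Sum>i\<in>UNIV. v $ i *\<^sub>R ang1 i u) \<bullet> (\<Sum>j\<in>UNIV. w $ j *\<^sub>R ang1 j u) =
      (\<Sum>i\<in>UNIV. \<Sum>j\<in>UNIV. v $ i * w $ j * sph u i j)"
    by (subst inner_sum_left) (simp add: inner_sum_right sph_def sum_distrib_left mult_ac)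
  moreover have "metric_inner G u v w =
      (\<Sum>i\<in>UNIV. \<Sum>j\<in>UNIV. (v $ i * rad1 i u) * (w $ j * rad1 j u))
      + (h (rad u))\<^sup>2 * (\<Sum>i\<in>UNIV. \<Sum>j\<in>UNIV. v $ i * w $ j * sph u i j)"
    by (simp add: metric_inner_def G_eq[OF assms] sum_distrib_left sum.distrib[symmetric] distrib_left distrib_right
        mult_ac)
  ultimately show ?thesis
    by (simp add: dphi_eq[OF assms] warped_metric_def[of h "\<phi> u"] rad_def sum_product)
qed

lemma metric_inner_pos:
  assumes "u \<in> U" "v \<noteq> 0"
  shows "metric_inner G u v v > 0"
proof -
  obtain a b where ab: "frechet_derivative \<phi> (at u) v = (a, b)" by fastforce
  have "(a, b) \<noteq> 0"
    using inj_phi[OF assms(1)] assms(2) linear_0[OF linear_dphi[OF assms(1)]] ab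
    by (metis injD)
  moreover have "h (fst (\<phi> u)) > 0"
    using h_pos rad_in_I[OF assms(1)] by (simp add: rad_def)
  moreover have "metric_inner G u v v = a\<^sup>2 + (h (fst (\<phi> u)))\<^sup>2 * (b \<bullet> b)"
    using ab by (simp add: metric_inner_eq[OF assms(1)] warped_metric_def power2_eq_square)
  ultimately show ?thesis
    by (cases "b = 0") (auto simp: zero_prod_def intro!: add_nonneg_pos)
qed

lemma G_mult_inner: "metric_inner G u v w = v \<bullet> (G u *v w)"
  by (simp add: metric_inner_def inner_vec_def matrix_vector_mult_def sum_distrib_left algebra_simps)

lemma invertible_G:
  assumes "u \<in> U"
  shows "invertible (G u)"
proof -
  have "G u *v x = 0 \<longrightarrow> x = 0" for x
    using metric_inner_pos[OF assms, of x] by (cases "x = 0") (auto simp: G_mult_inner)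
  then show ?thesis
    using invertible_left_inverse matrix_left_invertible_ker by blast
qed

text \<open>A dimension count: the injective derivative has an n-dimensional range inside the
  hyperplane of R x R^n orthogonal to (0, \<open>ang u\<close>), and that hyperplane has dimension n
  as well.\<close>

lemma tangent_surj:
  assumes "u \<in> U" "q \<bullet> ang u = 0"
  obtains c where "p = (\<Sum>k\<in>UNIV. c $ k * rad1 k u)" "q = (\<Sum>k\<in>UNIV. c $ k *\<^sub>R ang1 k u)"
proof -
  let ?L = "frechet_derivative \<phi> (at u)"
  let ?H = "{y. (0::real, ang u) \<bullet> y = 0}"
  have "ang u \<noteq> 0" using ang_unit[OF assms(1)] by auto
  then have dimH: "dim ?H = CARD('n)"
    using dim_hyperplane[of "(0::real, ang u)"] by (simp add: zero_prod_def)
  have sub: "range ?L \<subseteq> ?H"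
    using ang1_ang[OF assms(1)]
    by (auto simp: dphi_eq[OF assms(1)] inner_sum_right inner_commute[of "ang u"])
  have "dim (range ?L) = CARD('n)"
    using dim_image_eq[OF linear_dphi[OF assms(1)], of UNIV] inj_phi[OF assms(1)] by simp
  then have "range ?L = ?H"
    using subspace_dim_equal[of "range ?L" ?H] sub dimH
      linear_subspace_image[OF linear_dphi[OF assms(1)] subspace_UNIV]
    by (simp add: subspace_hyperplane)
  moreover have "(p, q) \<in> ?H" using assms(2) by (simp add: inner_commute)
  ultimately obtain c where "(p, q) = ?L c" by blast
  then show ?thesis using that by (simp add: dphi_eq[OF assms(1)])
qed

section \<open>Christoffel symbols and Gauss formulas\<close>

lemma diff_h: "u \<in> U \<Longrightarrow> (\<lambda>x. h (rad x)) differentiable (at u)"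
  by (rule real_derivative_compose_differentiable[OF diff_rad h_deriv[OF rad_in_I]])

lemma diff_h': "u \<in> U \<Longrightarrow> (\<lambda>x. h' (rad x)) differentiable (at u)"
  by (rule real_derivative_compose_differentiable[OF diff_rad h'_deriv[OF rad_in_I]])

lemma partial_h: "u \<in> U \<Longrightarrow> partial i (\<lambda>x. h (rad x)) u = h' (rad u) * rad1 i u"
  unfolding rad1_def by (rule partial_compose[OF diff_rad h_deriv[OF rad_in_I]])

lemma partial_h': "u \<in> U \<Longrightarrow> partial i (\<lambda>x. h' (rad x)) u = h'' (rad u) * rad1 i u"
  unfolding rad1_def by (rule partial_compose[OF diff_rad h'_deriv[OF rad_in_I]])

lemma diff_sph: "u \<in> U \<Longrightarrow> (\<lambda>x. sph x i j) differentiable (at u)"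
  unfolding sph_def by (intro differentiable_inner diff_ang1)

lemma partial_sph:
  "u \<in> U \<Longrightarrow> partial i (\<lambda>x. sph x j k) u = ang2 i j u \<bullet> ang1 k u + ang1 j u \<bullet> ang2 i k u"
  unfolding sph_def by (simp add: partial_inner diff_ang1 ang2_def)

lemma partial_G:
  assumes "u \<in> U"
  shows "partial k (\<lambda>x. G x $ i $ j) u = rad2 k i u * rad1 j u + rad1 i u * rad2 k j u
    + 2 * h (rad u) * h' (rad u) * rad1 k u * sph u i j
    + (h (rad u))\<^sup>2 * (ang2 k i u \<bullet> ang1 j u + ang1 i u \<bullet> ang2 k j u)"
proof -
  note d = diff_rad1[OF assms] diff_h[OF assms] diff_sph[OF assms]
  have "partial k (\<lambda>x. G x $ i $ j) u =
      partial k (\<lambda>x. rad1 i x * rad1 j x + (h (rad x) * h (rad x)) * sph x i j) u"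
    by (rule partial_cong[OF open_U assms, symmetric])
      (use d in \<open>auto simp: G_eq power2_eq_square intro!: differentiable_add differentiable_mult\<close>)
  also have "\<dots> = rad2 k i u * rad1 j u + rad1 i u * rad2 k j u
      + 2 * h (rad u) * h' (rad u) * rad1 k u * sph u i j
      + (h (rad u))\<^sup>2 * (ang2 k i u \<bullet> ang1 j u + ang1 i u \<bullet> ang2 k j u)"
    using d by (simp add: partial_add partial_mult partial_h[OF assms] partial_sph[OF assms]
        rad2_def[symmetric] algebra_simps power2_eq_square)
  finally show ?thesis .
qed

text \<open>The usual cancellation for Christoffel symbols of the first kind: by symmetry of second
  derivatives only the pairing of the second derivatives in \<open>i\<close>, \<open>j\<close> with
  the first derivative in \<open>l\<close> survives. The terms with \<open>h'\<close> come from
  differentiating h^2.\<close>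

lemma christoffel_lower:
  assumes "u \<in> U"
  shows "partial i (\<lambda>x. G x $ j $ l) u + partial j (\<lambda>x. G x $ i $ l) u - partial l (\<lambda>x. G x $ i $ j) u =
    2 * (rad2 i j u * rad1 l u + (h (rad u))\<^sup>2 * (ang2 i j u \<bullet> ang1 l u)
      + h (rad u) * h' (rad u) * (rad1 i u * sph u j l + rad1 j u * sph u i l - rad1 l u * sph u i j))"
  unfolding partial_G[OF assms]
  using rad2_symmetric[OF assms, of j i] rad2_symmetric[OF assms, of l i] rad2_symmetric[OF assms, of l j]
    ang2_symmetric[OF assms, of j i] ang2_symmetric[OF assms, of l i] ang2_symmetric[OF assms, of l j]
  by (simp add: algebra_simps inner_commute)

text \<open>
  The right-hand sides are tangent to the image of \<open>\<phi>\<close>, so they are combinations of the \<open>\<partial>\<^sub>k\<phi>\<close>;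
  taking inner products with \<open>\<partial>\<^sub>l\<phi>\<close> identifies the coefficients as \<open>\<Gamma>\<^sup>k\<^sub>i\<^sub>j\<close>.
\<close>

lemma gauss_formula:
  assumes "u \<in> U"
  shows "(\<Sum>k\<in>UNIV. \<Gamma> u k i j * rad1 k u) = rad2 i j u - h (rad u) * h' (rad u) * sph u i j"
    and "(\<Sum>k\<in>UNIV. \<Gamma> u k i j *\<^sub>R ang1 k u) = ang2 i j u + sph u i j *\<^sub>R ang u
      + (h' (rad u) / h (rad u)) *\<^sub>R (rad1 i u *\<^sub>R ang1 j u + rad1 j u *\<^sub>R ang1 i u)"
proof -
  define p where "p = rad2 i j u - h (rad u) * h' (rad u) * sph u i j"
  define q where "q = ang2 i j u + sph u i j *\<^sub>R ang u
      + (h' (rad u) / h (rad u)) *\<^sub>R (rad1 i u *\<^sub>R ang1 j u + rad1 j u *\<^sub>R ang1 i u)"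
  have h: "h (rad u) \<noteq> 0"
    using h_pos[OF rad_in_I[OF assms]] by simp
  \<comment> \<open>The summand \<open>sph u i j *\<^sub>R ang u\<close> is there to cancel the
    normal component of \<open>ang2 i j u\<close>.\<close>
  have "q \<bullet> ang u = 0"
    using ang2_ang[OF assms] ang_unit[OF assms] ang1_ang[OF assms]
    by (simp add: q_def inner_add_left)
  from tangent_surj[OF assms this, of p] obtain c
    where c: "p = (\<Sum>k\<in>UNIV. c $ k * rad1 k u)" "q = (\<Sum>k\<in>UNIV. c $ k *\<^sub>R ang1 k u)" .
  have low: "(G u *v c) $ l = rad2 i j u * rad1 l u + (h (rad u))\<^sup>2 * (ang2 i j u \<bullet> ang1 l u)
      + h (rad u) * h' (rad u) * (rad1 i u * sph u j l + rad1 j u * sph u i l - rad1 l u * sph u i j)"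
    for l
  proof -
    have "(G u *v c) $ l = rad1 l u * p + (h (rad u))\<^sup>2 * (ang1 l u \<bullet> q)"
      unfolding c by (simp add: matrix_vector_mult_def G_eq[OF assms] sph_def inner_sum_right
          sum_distrib_left sum.distrib[symmetric] algebra_simps)
    also have "\<dots> = rad2 i j u * rad1 l u + (h (rad u))\<^sup>2 * (ang2 i j u \<bullet> ang1 l u)
      + h (rad u) * h' (rad u) * (rad1 i u * sph u j l + rad1 j u * sph u i l - rad1 l u * sph u i j)"
      using h ang1_ang[OF assms, of l]
      by (simp add: p_def q_def inner_add_right inner_commute[of "ang1 l u"] sph_def[symmetric]
          sph_symmetric[of u l] power2_eq_square field_simps)
    finally show ?thesis .
  qed
  have "\<Gamma> u k i j = c $ k" for k
  proof -
    have "\<Gamma> u k i j = (\<Sum>l\<in>UNIV. matrix_inv (G u) $ k $ l * (G u *v c) $ l)"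
      unfolding christoffel_def pd_eq_partial christoffel_lower[OF assms] low[symmetric]
      by (simp add: sum_distrib_left)
    also have "\<dots> = (matrix_inv (G u) *v (G u *v c)) $ k"
      by (simp add: matrix_vector_mult_def)
    also have "\<dots> = c $ k"
      by (simp add: matrix_vector_mul_assoc matrix_inv_left[OF invertible_G[OF assms]])
    finally show ?thesis .
  qed
  then show "(\<Sum>k\<in>UNIV. \<Gamma> u k i j * rad1 k u) = rad2 i j u - h (rad u) * h' (rad u) * sph u i j"
    and "(\<Sum>k\<in>UNIV. \<Gamma> u k i j *\<^sub>R ang1 k u) = ang2 i j u + sph u i j *\<^sub>R ang u
      + (h' (rad u) / h (rad u)) *\<^sub>R (rad1 i u *\<^sub>R ang1 j u + rad1 j u *\<^sub>R ang1 i u)"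
    using c by (simp_all add: p_def q_def)
qed

section \<open>Riemann tensor from integrability conditions\<close>

lemma diff_G: "u \<in> U \<Longrightarrow> (\<lambda>x. G x $ i $ j) differentiable (at u)"
  and smooth_G: "smooth_on U (\<lambda>x. G x $ i $ j)"
proof -
  have "smooth_on U (\<lambda>x. rad1 i x * rad1 j x + (h (rad x))\<^sup>2 * (ang1 i x \<bullet> ang1 j x))"
    by (intro smooth_on_add smooth_on_mult smooth_on_power smooth_on_inner open_U smooth_rad1
        smooth_ang1 smooth_on_compose[OF _ smooth_h] smooth_rad) (use rad_in_I in auto)
  then show G: "smooth_on U (\<lambda>x. G x $ i $ j)"
    using smooth_on_cong[OF open_U, of "\<lambda>x. G x $ i $ j"] by (simp add: G_eq sph_def)
  show "u \<in> U \<Longrightarrow> (\<lambda>x. G x $ i $ j) differentiable (at u)"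
    using smooth_on_differentiable[OF G] .
qed

text \<open>Differentiability is all that enters later: the derivatives of the symbols stay symbolic
  until the integrability conditions eliminate them.\<close>

lemma diff_christoffel: "u \<in> U \<Longrightarrow> (\<lambda>x. \<Gamma> x k i j) differentiable (at u)"
  unfolding christoffel_def pd_eq_partial
  by (intro differentiable_mult differentiable_const differentiable_sum ballI differentiable_add
      differentiable_diff smooth_on_differentiable[OF partial_smooth[OF smooth_G]]
      matrix_inv_entry_differentiable[OF open_U] invertible_G diff_G) simp_all

text \<open>The quadratic terms are regrouped so that each inner sum is the left side of a Gauss
  formula. \<open>X\<close> will be the family \<open>rad1\<close> or \<open>ang1\<close>, hence the
  general vector space.\<close>

lemma riemann_contract:
  fixes X :: "'n \<Rightarrow> 'b::real_vector"
  shows "(\<Sum>l\<in>UNIV. riemann G u l i j k *\<^sub>R X l) =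
    (\<Sum>l\<in>UNIV. partial i (\<lambda>x. \<Gamma> x l j k) u *\<^sub>R X l) - (\<Sum>l\<in>UNIV. partial j (\<lambda>x. \<Gamma> x l i k) u *\<^sub>R X l)
    + (\<Sum>m\<in>UNIV. \<Gamma> u m j k *\<^sub>R (\<Sum>l\<in>UNIV. \<Gamma> u l i m *\<^sub>R X l))
    - (\<Sum>m\<in>UNIV. \<Gamma> u m i k *\<^sub>R (\<Sum>l\<in>UNIV. \<Gamma> u l j m *\<^sub>R X l))"
proof -
  have swap: "(\<Sum>m\<in>UNIV. \<Gamma> u m j k *\<^sub>R (\<Sum>l\<in>UNIV. \<Gamma> u l i m *\<^sub>R X l)) =
      (\<Sum>l\<in>UNIV. (\<Sum>m\<in>UNIV. \<Gamma> u l i m * \<Gamma> u m j k) *\<^sub>R X l)" for i j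
    unfolding scaleR_sum_right scaleR_sum_left by (subst sum.swap) (simp add: mult.commute)
  show ?thesis
    unfolding swap riemann_def pd_eq_partial
    by (simp add: sum_subtractf sum.distrib scaleR_add_left scaleR_diff_left)
qed

text \<open>The angular Gauss formula paired with \<open>ang1 i u\<close>, which kills the term
  along the normal \<open>ang u\<close>.\<close>

lemma christoffel_contract_sph:
  assumes "u \<in> U"
  shows "(\<Sum>m\<in>UNIV. \<Gamma> u m j k * sph u i m) = ang2 j k u \<bullet> ang1 i u
    + h' (rad u) / h (rad u) * (rad1 j u * sph u k i + rad1 k u * sph u j i)"
proof -
  have "(\<Sum>m\<in>UNIV. \<Gamma> u m j k * sph u i m) = (\<Sum>m\<in>UNIV. \<Gamma> u m j k *\<^sub>R ang1 m u) \<bullet> ang1 i u"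
    by (simp add: inner_sum_left sph_def inner_commute[of "ang1 i u"])
  then show ?thesis
    unfolding gauss_formula(2)[OF assms]
    using ang1_ang[OF assms, of i]
    by (simp add: inner_add_left sph_def inner_commute[of "ang u"])
qed

text \<open>The radial Gauss formula, solved for \<open>rad2 j k\<close> and differentiated. The
  left side is a third derivative of the radius, hence symmetric in \<open>i\<close> and
  \<open>j\<close>.\<close>

lemma rad_integrability:
  assumes "u \<in> U"
  shows "partial i (rad2 j k) u = (\<Sum>l\<in>UNIV. partial i (\<lambda>x. \<Gamma> x l j k) u * rad1 l u)
    + (\<Sum>l\<in>UNIV. \<Gamma> u l j k * rad2 i l u)
    + ((h' (rad u))\<^sup>2 + h (rad u) * h'' (rad u)) * rad1 i u * sph u j k
    + h (rad u) * h' (rad u) * (ang2 i j u \<bullet> ang1 k u + ang1 j u \<bullet> ang2 i k u)"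
proof -
  note d = diff_christoffel[OF assms] diff_rad1[OF assms] diff_h[OF assms] diff_h'[OF assms]
    diff_sph[OF assms]
  have "partial i (rad2 j k) u = partial i (\<lambda>x. (\<Sum>l\<in>UNIV. \<Gamma> x l j k * rad1 l x)
      + h (rad x) * h' (rad x) * sph x j k) u"
    by (rule partial_cong[OF open_U assms diff_rad2[OF assms]]) (simp add: gauss_formula(1))
  also have "\<dots> = (\<Sum>l\<in>UNIV. partial i (\<lambda>x. \<Gamma> x l j k) u * rad1 l u)
    + (\<Sum>l\<in>UNIV. \<Gamma> u l j k * rad2 i l u)
    + ((h' (rad u))\<^sup>2 + h (rad u) * h'' (rad u)) * rad1 i u * sph u j k
    + h (rad u) * h' (rad u) * (ang2 i j u \<bullet> ang1 k u + ang1 j u \<bullet> ang2 i k u)"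
    using d by (simp add: partial_add partial_sum partial_mult differentiable_mult differentiable_sum
        partial_h[OF assms] partial_h'[OF assms] partial_sph[OF assms] rad2_def[symmetric]
        sum.distrib power2_eq_square algebra_simps)
  finally show ?thesis .
qed

text \<open>Antisymmetrizing \<open>rad_integrability\<close> in \<open>i\<close> and
  \<open>j\<close> trades the derivatives of the symbols for known terms. The contributions of h'^2
  cancel against those of \<open>christoffel_contract_sph\<close>, and only h h'' remains.\<close>

lemma riemann_rad:
  assumes "u \<in> U"
  shows "(\<Sum>l\<in>UNIV. riemann G u l i j k * rad1 l u) =
    - h (rad u) * h'' (rad u) * (rad1 i u * sph u j k - rad1 j u * sph u i k)"
proof -
  have contract: "(\<Sum>m\<in>UNIV. \<Gamma> u m j k * (\<Sum>l\<in>UNIV. \<Gamma> u l i m * rad1 l u)) =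
      (\<Sum>m\<in>UNIV. \<Gamma> u m j k * rad2 i m u)
      - h (rad u) * h' (rad u) * (\<Sum>m\<in>UNIV. \<Gamma> u m j k * sph u i m)" for i j
    unfolding gauss_formula(1)[OF assms]
    by (simp add: right_diff_distrib sum_subtractf sum_distrib_left mult_ac)
  have sym: "partial i (rad2 j k) u = partial j (rad2 i k) u"
    unfolding rad2_def by (rule partial_symmetric[OF open_U smooth_rad1 assms])
  have h: "h (rad u) \<noteq> 0"
    using h_pos[OF rad_in_I[OF assms]] by simp
  have "(\<Sum>l\<in>UNIV. riemann G u l i j k * rad1 l u) =
      (\<Sum>l\<in>UNIV. partial i (\<lambda>x. \<Gamma> x l j k) u * rad1 l u) - (\<Sum>l\<in>UNIV. partial j (\<lambda>x. \<Gamma> x l i k) u * rad1 l u)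
      + (\<Sum>m\<in>UNIV. \<Gamma> u m j k * rad2 i m u)
      - h (rad u) * h' (rad u) * (\<Sum>m\<in>UNIV. \<Gamma> u m j k * sph u i m)
      - (\<Sum>m\<in>UNIV. \<Gamma> u m i k * rad2 j m u)
      + h (rad u) * h' (rad u) * (\<Sum>m\<in>UNIV. \<Gamma> u m i k * sph u j m)"
    using riemann_contract[of u i j k "\<lambda>l. rad1 l u"] contract[of i j] contract[of j i] by simp
  also have "\<dots> = ((h' (rad u))\<^sup>2 + h (rad u) * h'' (rad u)) * rad1 j u * sph u i k
      + h (rad u) * h' (rad u) * (ang2 j i u \<bullet> ang1 k u + ang1 i u \<bullet> ang2 j k u)
      - ((h' (rad u))\<^sup>2 + h (rad u) * h'' (rad u)) * rad1 i u * sph u j k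
      - h (rad u) * h' (rad u) * (ang2 i j u \<bullet> ang1 k u + ang1 j u \<bullet> ang2 i k u)
      - h (rad u) * h' (rad u) * (\<Sum>m\<in>UNIV. \<Gamma> u m j k * sph u i m)
      + h (rad u) * h' (rad u) * (\<Sum>m\<in>UNIV. \<Gamma> u m i k * sph u j m)"
    using rad_integrability[OF assms, of i j k] rad_integrability[OF assms, of j i k] sym by linarith
  also have "\<dots> = - h (rad u) * h'' (rad u) * (rad1 i u * sph u j k - rad1 j u * sph u i k)"
    unfolding christoffel_contract_sph[OF assms]
    using h ang2_symmetric[OF assms, of j i] sph_symmetric[of u j i] sph_symmetric[of u k i]
      sph_symmetric[of u k j]
    by (simp add: field_simps power2_eq_square inner_commute[of "ang1 _ u" "ang2 _ _ u"])
  finally show ?thesis .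
qed

lemma ang_integrability:
  assumes "u \<in> U"
  shows "partial i (ang2 j k) u = (\<Sum>l\<in>UNIV. partial i (\<lambda>x. \<Gamma> x l j k) u *\<^sub>R ang1 l u)
    + (\<Sum>l\<in>UNIV. \<Gamma> u l j k *\<^sub>R ang2 i l u)
    - (ang2 i j u \<bullet> ang1 k u + ang1 j u \<bullet> ang2 i k u) *\<^sub>R ang u - sph u j k *\<^sub>R ang1 i u
    - ((h'' (rad u) / h (rad u) - (h' (rad u) / h (rad u))\<^sup>2) * rad1 i u) *\<^sub>R
        (rad1 j u *\<^sub>R ang1 k u + rad1 k u *\<^sub>R ang1 j u)
    - (h' (rad u) / h (rad u)) *\<^sub>R (rad2 i j u *\<^sub>R ang1 k u + rad1 j u *\<^sub>R ang2 i k u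
        + rad2 i k u *\<^sub>R ang1 j u + rad1 k u *\<^sub>R ang2 i j u)"
proof -
  have h: "h (rad u) \<noteq> 0"
    using h_pos[OF rad_in_I[OF assms]] by simp
  \<comment> \<open>The quotient h'/h satisfies the Riccati relation (h'/h)' = h''/h -
    (h'/h)^2.\<close>
  have q: "((\<lambda>t. h' t / h t) has_real_derivative h'' (rad u) / h (rad u) - (h' (rad u) / h (rad u))\<^sup>2)
      (at (rad u))"
    using h by (auto intro!: derivative_eq_intros h_deriv h'_deriv rad_in_I assms
        simp: field_simps power2_eq_square)
  note dq = real_derivative_compose_differentiable[OF diff_rad[OF assms] q]
  note pq = partial_compose[OF diff_rad[OF assms] q, folded rad1_def]
  note d = diff_christoffel[OF assms] diff_rad1[OF assms] diff_ang1[OF assms] dq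
    diff_sph[OF assms] diff_ang[OF assms]
  have "partial i (ang2 j k) u = partial i (\<lambda>x. (\<Sum>l\<in>UNIV. \<Gamma> x l j k *\<^sub>R ang1 l x) - sph x j k *\<^sub>R ang x
      - (h' (rad x) / h (rad x)) *\<^sub>R (rad1 j x *\<^sub>R ang1 k x + rad1 k x *\<^sub>R ang1 j x)) u"
    by (rule partial_cong[OF open_U assms diff_ang2[OF assms]]) (simp add: gauss_formula(2))
  also have "\<dots> = (\<Sum>l\<in>UNIV. \<Gamma> u l j k *\<^sub>R ang2 i l u + partial i (\<lambda>x. \<Gamma> x l j k) u *\<^sub>R ang1 l u)
      - (sph u j k *\<^sub>R ang1 i u + (ang2 i j u \<bullet> ang1 k u + ang1 j u \<bullet> ang2 i k u) *\<^sub>R ang u)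
      - ((h' (rad u) / h (rad u)) *\<^sub>R (rad1 j u *\<^sub>R ang2 i k u + rad2 i j u *\<^sub>R ang1 k u
          + (rad1 k u *\<^sub>R ang2 i j u + rad2 i k u *\<^sub>R ang1 j u))
        + ((h'' (rad u) / h (rad u) - (h' (rad u) / h (rad u))\<^sup>2) * rad1 i u) *\<^sub>R
          (rad1 j u *\<^sub>R ang1 k u + rad1 k u *\<^sub>R ang1 j u))"
    using d by (simp add: partial_add partial_diff partial_sum partial_scaleR differentiable_scaleR
        differentiable_sum pq partial_sph[OF assms] rad2_def[symmetric] ang2_def[symmetric]
        ang1_def[symmetric])
  finally show ?thesis
    by (simp add: sum.distrib algebra_simps)
qed

lemma riemann_ang:
  assumes "u \<in> U"
  shows "(\<Sum>l\<in>UNIV. riemann G u l i j k *\<^sub>R ang1 l u) =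
    (1 - (h' (rad u))\<^sup>2) *\<^sub>R (sph u j k *\<^sub>R ang1 i u - sph u i k *\<^sub>R ang1 j u)
    - (h'' (rad u) / h (rad u) * rad1 k u) *\<^sub>R (rad1 j u *\<^sub>R ang1 i u - rad1 i u *\<^sub>R ang1 j u)"
proof -
  let ?q = "h' (rad u) / h (rad u)"
  have contract: "(\<Sum>m\<in>UNIV. \<Gamma> u m j k *\<^sub>R (\<Sum>l\<in>UNIV. \<Gamma> u l i m *\<^sub>R ang1 l u)) =
      (\<Sum>m\<in>UNIV. \<Gamma> u m j k *\<^sub>R ang2 i m u) + (\<Sum>m\<in>UNIV. \<Gamma> u m j k * sph u i m) *\<^sub>R ang u
      + ?q *\<^sub>R (rad1 i u *\<^sub>R (\<Sum>m\<in>UNIV. \<Gamma> u m j k *\<^sub>R ang1 m u)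
        + (\<Sum>m\<in>UNIV. \<Gamma> u m j k * rad1 m u) *\<^sub>R ang1 i u)" for i j
  proof -
    have "(\<Sum>m\<in>UNIV. \<Gamma> u m j k *\<^sub>R (\<Sum>l\<in>UNIV. \<Gamma> u l i m *\<^sub>R ang1 l u)) =
        (\<Sum>m\<in>UNIV. \<Gamma> u m j k *\<^sub>R ang2 i m u + (\<Gamma> u m j k * sph u i m) *\<^sub>R ang u
          + ?q *\<^sub>R (rad1 i u *\<^sub>R (\<Gamma> u m j k *\<^sub>R ang1 m u) + (\<Gamma> u m j k * rad1 m u) *\<^sub>R ang1 i u))"
      unfolding gauss_formula(2)[OF assms]
      by (intro sum.cong refl) (simp add: algebra_simps)
    then show ?thesis
      by (simp only: sum.distrib scaleR_sum_right scaleR_sum_left scaleR_add_right)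
  qed
  have sym: "partial i (ang2 j k) u = partial j (ang2 i k) u"
    unfolding ang2_def by (rule partial_symmetric[OF open_U smooth_ang1 assms])
  have h: "h (rad u) \<noteq> 0"
    using h_pos[OF rad_in_I[OF assms]] by simp
  \<comment> \<open>\<open>S1\<close> and \<open>S2\<close> occur identically in the integrability
    condition and in the contracted curvature, so they drop out. \<open>T\<close> holds the
    remaining terms of the former, \<open>E\<close> those of the latter.\<close>
  define S1 where "S1 i j = (\<Sum>l\<in>UNIV. partial i (\<lambda>x. \<Gamma> x l j k) u *\<^sub>R ang1 l u)" for i j
  define S2 where "S2 i j = (\<Sum>m\<in>UNIV. \<Gamma> u m j k *\<^sub>R ang2 i m u)" for i j
  define E where "E i j = (\<Sum>m\<in>UNIV. \<Gamma> u m j k * sph u i m) *\<^sub>R ang u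
      + ?q *\<^sub>R (rad1 i u *\<^sub>R (\<Sum>m\<in>UNIV. \<Gamma> u m j k *\<^sub>R ang1 m u)
        + (\<Sum>m\<in>UNIV. \<Gamma> u m j k * rad1 m u) *\<^sub>R ang1 i u)" for i j
  define T where "T i j = (ang2 i j u \<bullet> ang1 k u + ang1 j u \<bullet> ang2 i k u) *\<^sub>R ang u + sph u j k *\<^sub>R ang1 i u
    + ((h'' (rad u) / h (rad u) - ?q\<^sup>2) * rad1 i u) *\<^sub>R
        (rad1 j u *\<^sub>R ang1 k u + rad1 k u *\<^sub>R ang1 j u)
    + ?q *\<^sub>R (rad2 i j u *\<^sub>R ang1 k u + rad1 j u *\<^sub>R ang2 i k u
        + rad2 i k u *\<^sub>R ang1 j u + rad1 k u *\<^sub>R ang2 i j u)" for i j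
  have int: "partial i (ang2 j k) u = S1 i j + S2 i j - T i j" for i j
    unfolding ang_integrability[OF assms] S1_def S2_def T_def by (simp add: algebra_simps)
  have "(\<Sum>l\<in>UNIV. riemann G u l i j k *\<^sub>R ang1 l u) =
      (S1 i j + S2 i j) - (S1 j i + S2 j i) + E i j - E j i"
    unfolding riemann_contract contract S1_def S2_def E_def by (simp add: algebra_simps)
  also have "\<dots> = T i j - T j i + E i j - E j i"
    using sym unfolding int by (simp add: algebra_simps)
  finally have eq: "(\<Sum>l\<in>UNIV. riemann G u l i j k *\<^sub>R ang1 l u) = T i j - T j i + E i j - E j i" .
  show ?thesis
    unfolding eq
  \<comment> \<open>Pairing with an arbitrary vector \<open>z\<close> turns the claim into an
    identity between real numbers, where division by h can be cleared.\<close>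
  proof (rule vector_eq_rdot[THEN iffD1, rule_format])
    fix z
    show "(T i j - T j i + E i j - E j i) \<bullet> z =
      ((1 - (h' (rad u))\<^sup>2) *\<^sub>R (sph u j k *\<^sub>R ang1 i u - sph u i k *\<^sub>R ang1 j u)
      - (h'' (rad u) / h (rad u) * rad1 k u) *\<^sub>R (rad1 j u *\<^sub>R ang1 i u - rad1 i u *\<^sub>R ang1 j u)) \<bullet> z"
      unfolding T_def E_def christoffel_contract_sph[OF assms] gauss_formula[OF assms]
      using h ang2_symmetric[OF assms, of j i] rad2_symmetric[OF assms, of j i]
        sph_symmetric[of u j i] sph_symmetric[of u k i] sph_symmetric[of u k j]
      by (simp add: inner_add_left inner_diff_left inner_commute[of "ang1 _ u" "ang2 _ _ u"]
          power2_eq_square field_simps)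
  qed
qed

text \<open>
  \<open>radial_curv\<close> is the curvature of the planes containing \<open>\<partial>\<^sub>r\<close>; \<open>sph_curv / h\<^sup>2\<close> is the curvature
  of the planes orthogonal to \<open>\<partial>\<^sub>r\<close>.
\<close>

definition "radial_curv u = - h'' (rad u) / h (rad u)"
definition "sph_curv u = 1 - (h' (rad u))\<^sup>2"

section \<open>The curvature tensor in coordinates and its traces\<close>

lemma h_rad_pos: "u \<in> U \<Longrightarrow> h (rad u) > 0"
  by (rule h_pos[OF rad_in_I])

text \<open>\<open>\<nu>\<close> is the coordinate vector of the unit radial field: the derivative
  of the chart maps it to (1, 0).\<close>

lemma radial_field:
  assumes "u \<in> U"
  obtains \<nu> where "(\<Sum>k\<in>UNIV. \<nu> $ k * rad1 k u) = 1" "(\<Sum>k\<in>UNIV. \<nu> $ k *\<^sub>R ang1 k u) = 0"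
  using tangent_surj[OF assms, of 0 1] by (metis inner_zero_left)

lemma tangent_coeffs_unique:
  assumes "u \<in> U" "(\<Sum>k\<in>UNIV. a k * rad1 k u) = (\<Sum>k\<in>UNIV. b k * rad1 k u)"
    "(\<Sum>k\<in>UNIV. a k *\<^sub>R ang1 k u) = (\<Sum>k\<in>UNIV. b k *\<^sub>R ang1 k u)"
  shows "a k = b k"
proof -
  have "frechet_derivative \<phi> (at u) (\<chi> k. a k) = frechet_derivative \<phi> (at u) (\<chi> k. b k)"
    using assms(2,3) by (simp add: dphi_eq[OF assms(1)])
  then have "(\<chi> k. a k) = (\<chi> k. b k)"
    using inj_phi[OF assms(1)] by (simp add: inj_eq)
  then show ?thesis by (simp add: vec_eq_iff)
qed

text \<open>By injectivity it suffices to compare images under the derivative of the chart. The two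
  Kronecker terms reproduce \<open>riemann_ang\<close>; the term with \<open>\<nu>\<close> has no
  angular part and adjusts the radial component to \<open>riemann_rad\<close>. It disappears for
  constant curvature, where \<open>radial_curv\<close> times h^2 equals
  \<open>sph_curv\<close>.\<close>

lemma riemann_eq:
  assumes "u \<in> U" "(\<Sum>k\<in>UNIV. \<nu> $ k * rad1 k u) = 1" "(\<Sum>k\<in>UNIV. \<nu> $ k *\<^sub>R ang1 k u) = 0"
  shows "riemann G u l i j k =
    (radial_curv u * (h (rad u))\<^sup>2 - sph_curv u) * (rad1 i u * sph u j k - rad1 j u * sph u i k) * \<nu> $ l
    + (sph_curv u * sph u j k + radial_curv u * rad1 j u * rad1 k u) * (if l = i then 1 else 0)
    - (sph_curv u * sph u i k + radial_curv u * rad1 i u * rad1 k u) * (if l = j then 1 else 0)"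
proof -
  define a where "a = (radial_curv u * (h (rad u))\<^sup>2 - sph_curv u) * (rad1 i u * sph u j k - rad1 j u * sph u i k)"
  define b where "b i j = sph_curv u * sph u j k + radial_curv u * rad1 j u * rad1 k u" for i j :: 'n
  have h: "h (rad u) \<noteq> 0" using h_rad_pos[OF assms(1)] by simp
  let ?c = "\<lambda>l. a * \<nu> $ l + b i j * (if l = i then 1 else 0) - b j i * (if l = j then 1 else 0)"
  have sums: "(\<Sum>l\<in>UNIV. ?c l *\<^sub>R X l) = a *\<^sub>R (\<Sum>l\<in>UNIV. \<nu> $ l *\<^sub>R X l) + b i j *\<^sub>R X i - b j i *\<^sub>R X j"
    for X :: "'n \<Rightarrow> 'c::real_vector"
  proof -
    have delta: "(\<Sum>l\<in>UNIV. (b * (if l = i then 1 else 0)) *\<^sub>R X l) = b *\<^sub>R X i" for b i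
      using sum.delta[of UNIV i "\<lambda>l. b *\<^sub>R X l"]
      by (simp add: if_distrib[of "\<lambda>c. (b * c) *\<^sub>R _"] cong: if_cong)
    show ?thesis
      unfolding scaleR_diff_left scaleR_add_left sum_subtractf sum.distrib delta
      by (simp add: scaleR_sum_right)
  qed
  have "riemann G u l i j k = ?c l"
  proof (rule tangent_coeffs_unique[OF assms(1), where a = "\<lambda>l. riemann G u l i j k" and b = ?c])
    show "(\<Sum>l\<in>UNIV. riemann G u l i j k * rad1 l u) = (\<Sum>l\<in>UNIV. ?c l * rad1 l u)"
      unfolding riemann_rad[OF assms(1)] sums[of "\<lambda>l. rad1 l u", unfolded real_scaleR_def] assms(2)
      using h by (simp add: a_def b_def radial_curv_def field_simps power2_eq_square)
    show "(\<Sum>l\<in>UNIV. riemann G u l i j k *\<^sub>R ang1 l u) = (\<Sum>l\<in>UNIV. ?c l *\<^sub>R ang1 l u)"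
      unfolding riemann_ang[OF assms(1)] sums assms(3)
      by (simp add: b_def radial_curv_def sph_curv_def algebra_simps)
  qed
  then show ?thesis by (simp add: a_def b_def)
qed

text \<open>In the trace, \<open>\<nu>\<close> pairs to 1 with \<open>rad1\<close> and to 0 with
  \<open>sph\<close>, while the Kronecker terms contribute n - 1 copies of the same bilinear
  form.\<close>

lemma ricci_eq:
  assumes "u \<in> U"
  shows "ricci G u j k = (real CARD('n) - 1) * radial_curv u * rad1 j u * rad1 k u
    + (radial_curv u * (h (rad u))\<^sup>2 + (real CARD('n) - 2) * sph_curv u) * sph u j k"
proof -
  obtain \<nu> where \<nu>: "(\<Sum>k\<in>UNIV. \<nu> $ k * rad1 k u) = 1" "(\<Sum>k\<in>UNIV. \<nu> $ k *\<^sub>R ang1 k u) = 0"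
    using radial_field[OF assms] .
  have \<nu>_sph: "(\<Sum>i\<in>UNIV. \<nu> $ i * sph u i k) = 0"
    using arg_cong[OF \<nu>(2), of "\<lambda>x. x \<bullet> ang1 k u"] by (simp add: inner_sum_left sph_def)
  define a where "a = radial_curv u * (h (rad u))\<^sup>2 - sph_curv u"
  define b where "b = sph_curv u * sph u j k + radial_curv u * rad1 j u * rad1 k u"
  have "ricci G u j k = (\<Sum>i\<in>UNIV. a * sph u j k * (\<nu> $ i * rad1 i u) - a * rad1 j u * (\<nu> $ i * sph u i k)
      + b - (if i = j then b else 0))"
    unfolding ricci_def riemann_eq[OF assms \<nu>]
    by (intro sum.cong) (auto simp: a_def b_def algebra_simps)
  also have "\<dots> = a * sph u j k * (\<Sum>i\<in>UNIV. \<nu> $ i * rad1 i u) - a * rad1 j u * (\<Sum>i\<in>UNIV. \<nu> $ i * sph u i k)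
      + real CARD('n) * b - b"
    by (simp add: sum.distrib sum_subtractf sum_distrib_left)
  finally show ?thesis
    unfolding \<nu>(1) \<nu>_sph by (simp add: a_def b_def algebra_simps)
qed

text \<open>This says |dr| = 1. As \<open>G u *v \<nu>\<close> has components
  \<open>rad1 j u\<close>, the gradient of the radius is \<open>\<nu>\<close>, without computing the
  inverse matrix.\<close>

lemma trace_rad1:
  assumes "u \<in> U"
  shows "(\<Sum>i\<in>UNIV. \<Sum>j\<in>UNIV. matrix_inv (G u) $ i $ j * (rad1 i u * rad1 j u)) = 1"
proof -
  obtain \<nu> where \<nu>: "(\<Sum>k\<in>UNIV. \<nu> $ k * rad1 k u) = 1" "(\<Sum>k\<in>UNIV. \<nu> $ k *\<^sub>R ang1 k u) = 0"
    using radial_field[OF assms] .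
  have \<nu>_sph: "(\<Sum>j\<in>UNIV. \<nu> $ j * sph u i j) = 0" for i
    using arg_cong[OF \<nu>(2), of "\<lambda>x. ang1 i u \<bullet> x"] by (simp add: inner_sum_right sph_def)
  have "(G u *v \<nu>) $ j = rad1 j u * (\<Sum>k\<in>UNIV. \<nu> $ k * rad1 k u)
      + (h (rad u))\<^sup>2 * (\<Sum>k\<in>UNIV. \<nu> $ k * sph u j k)" for j
    by (simp add: matrix_vector_mult_def G_eq[OF assms] sum_distrib_left sum.distrib[symmetric]
        algebra_simps)
  then have G\<nu>: "(G u *v \<nu>) $ j = rad1 j u" for j
    unfolding \<nu>(1) \<nu>_sph by simp
  have "(\<Sum>j\<in>UNIV. matrix_inv (G u) $ i $ j * rad1 j u) = \<nu> $ i" for i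
  proof -
    have "(\<Sum>j\<in>UNIV. matrix_inv (G u) $ i $ j * rad1 j u) = (matrix_inv (G u) *v (G u *v \<nu>)) $ i"
      by (simp add: matrix_vector_mult_def[of "matrix_inv (G u)"] G\<nu>)
    also have "\<dots> = \<nu> $ i"
      by (simp add: matrix_vector_mul_assoc matrix_inv_left[OF invertible_G[OF assms]])
    finally show ?thesis .
  qed
  moreover have "(\<Sum>j\<in>UNIV. matrix_inv (G u) $ i $ j * (rad1 i u * rad1 j u)) =
      (\<Sum>j\<in>UNIV. matrix_inv (G u) $ i $ j * rad1 j u) * rad1 i u" for i
    by (simp add: sum_distrib_left mult_ac)
  ultimately show ?thesis using \<nu>(1) by simp
qed

text \<open>Solved from tr G = n, the decomposition of the metric into its radial and spherical
  parts, and \<open>trace_rad1\<close>.\<close>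

lemma trace_sph:
  assumes "u \<in> U"
  shows "(\<Sum>i\<in>UNIV. \<Sum>j\<in>UNIV. matrix_inv (G u) $ i $ j * sph u i j) =
    (real CARD('n) - 1) / (h (rad u))\<^sup>2"
proof -
  have "(\<Sum>j\<in>UNIV. matrix_inv (G u) $ i $ j * G u $ i $ j) = 1" for i
  proof -
    have "(\<Sum>j\<in>UNIV. matrix_inv (G u) $ i $ j * G u $ i $ j) = (matrix_inv (G u) ** G u) $ i $ i"
      by (simp add: matrix_matrix_mult_def G_symmetric[OF assms, of i])
    then show ?thesis
      by (simp add: matrix_inv_left[OF invertible_G[OF assms]] mat_def)
  qed
  then have "(\<Sum>i\<in>UNIV. \<Sum>j\<in>UNIV. matrix_inv (G u) $ i $ j * G u $ i $ j) = real CARD('n)"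
    by simp
  moreover have "(\<Sum>i\<in>UNIV. \<Sum>j\<in>UNIV. matrix_inv (G u) $ i $ j * G u $ i $ j) =
      (\<Sum>i\<in>UNIV. \<Sum>j\<in>UNIV. matrix_inv (G u) $ i $ j * (rad1 i u * rad1 j u))
      + (h (rad u))\<^sup>2 * (\<Sum>i\<in>UNIV. \<Sum>j\<in>UNIV. matrix_inv (G u) $ i $ j * sph u i j)"
    unfolding G_eq[OF assms] by (simp add: distrib_left sum.distrib sum_distrib_left mult_ac)
  ultimately show ?thesis
    unfolding trace_rad1[OF assms] using h_rad_pos[OF assms] by (simp add: field_simps)
qed

lemma trace_combination:
  assumes "u \<in> U"
  shows "(\<Sum>i\<in>UNIV. \<Sum>j\<in>UNIV. matrix_inv (G u) $ i $ j * (a * rad1 i u * rad1 j u + b * sph u i j)) =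
    a + b * ((real CARD('n) - 1) / (h (rad u))\<^sup>2)"
proof -
  have "(\<Sum>i\<in>UNIV. \<Sum>j\<in>UNIV. matrix_inv (G u) $ i $ j * (a * rad1 i u * rad1 j u + b * sph u i j)) =
      a * (\<Sum>i\<in>UNIV. \<Sum>j\<in>UNIV. matrix_inv (G u) $ i $ j * (rad1 i u * rad1 j u))
      + b * (\<Sum>i\<in>UNIV. \<Sum>j\<in>UNIV. matrix_inv (G u) $ i $ j * sph u i j)"
    by (simp add: distrib_left sum.distrib sum_distrib_left mult_ac)
  then show ?thesis
    unfolding trace_rad1[OF assms] trace_sph[OF assms] by simp
qed

lemma scalar_curvature_eq:
  assumes "u \<in> U"
  shows "scalar_curvature G u =
    (real CARD('n) - 1) * (2 * radial_curv u + (real CARD('n) - 2) * (sph_curv u / (h (rad u))\<^sup>2))"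
  unfolding scalar_curvature_def ricci_eq[OF assms] trace_combination[OF assms]
  using h_rad_pos[OF assms] by (simp add: field_simps)

section \<open>Hessian and Laplacian of radial functions\<close>

context
  fixes f f' f'' :: "real \<Rightarrow> real"
  assumes f: "t \<in> I \<Longrightarrow> (f has_real_derivative f' t) (at t)"
    and f': "t \<in> I \<Longrightarrow> (f' has_real_derivative f'' t) (at t)"
begin

text \<open>The Gauss formula cancels the second derivatives of the radius. What remains is f'' dr^2
  + f' Hess r, where Hess r is h h' times the round metric.\<close>

lemma hessian_radial:
  assumes "u \<in> U"
  shows "hessian G (\<lambda>x. f (rad x)) u i j =
    f'' (rad u) * rad1 i u * rad1 j u + f' (rad u) * h (rad u) * h' (rad u) * sph u i j"
proof -
  have grad: "partial j (\<lambda>x. f (rad x)) x = f' (rad x) * rad1 j x" if "x \<in> U" for j x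
    unfolding rad1_def by (rule partial_compose[OF diff_rad[OF that] f[OF rad_in_I[OF that]]])
  note d = real_derivative_compose_differentiable[OF diff_rad[OF assms] f'[OF rad_in_I[OF assms]]]
  have "partial i (partial j (\<lambda>x. f (rad x))) u = partial i (\<lambda>x. f' (rad x) * rad1 j x) u"
    by (rule partial_cong[OF open_U assms, symmetric])
      (use d diff_rad1[OF assms] in \<open>auto simp: grad intro!: differentiable_mult\<close>)
  also have "\<dots> = f' (rad u) * rad2 i j u + f'' (rad u) * rad1 i u * rad1 j u"
    using partial_mult[OF d diff_rad1[OF assms], of i j]
      partial_compose[OF diff_rad[OF assms] f'[OF rad_in_I[OF assms]], of i]
    by (simp add: rad2_def rad1_def)
  finally have "partial i (partial j (\<lambda>x. f (rad x))) u =
      f' (rad u) * rad2 i j u + f'' (rad u) * rad1 i u * rad1 j u" .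
  moreover have "(\<Sum>k\<in>UNIV. \<Gamma> u k i j * partial k (\<lambda>x. f (rad x)) u) =
      f' (rad u) * (\<Sum>k\<in>UNIV. \<Gamma> u k i j * rad1 k u)"
    by (simp add: grad[OF assms] sum_distrib_left mult_ac)
  ultimately show ?thesis
    unfolding hessian_def pd_eq_partial[abs_def] gauss_formula(1)[OF assms]
    by (simp add: algebra_simps)
qed

lemma laplacian_radial:
  assumes "u \<in> U"
  shows "laplacian G (\<lambda>x. f (rad x)) u =
    f'' (rad u) + (real CARD('n) - 1) * (h' (rad u) / h (rad u)) * f' (rad u)"
  unfolding laplacian_def hessian_radial[OF assms] trace_combination[OF assms]
  using h_rad_pos[OF assms] by (simp add: field_simps power2_eq_square)

end

section \<open>Sectional curvature\<close>

lemma dphi_riemann_op: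
  assumes "u \<in> U"
    and "frechet_derivative \<phi> (at u) v = (a, \<alpha>)" "frechet_derivative \<phi> (at u) w = (b, \<beta>)"
  shows "frechet_derivative \<phi> (at u) (riemann_op G u v w w) =
    (radial_curv u * (h (rad u))\<^sup>2 * (a * (\<beta> \<bullet> \<beta>) - b * (\<alpha> \<bullet> \<beta>)),
     sph_curv u *\<^sub>R ((\<beta> \<bullet> \<beta>) *\<^sub>R \<alpha> - (\<alpha> \<bullet> \<beta>) *\<^sub>R \<beta>) + (radial_curv u * b) *\<^sub>R (b *\<^sub>R \<alpha> - a *\<^sub>R \<beta>))"
proof -
  let ?L = "frechet_derivative \<phi> (at u)"
  obtain \<nu> where \<nu>: "(\<Sum>k\<in>UNIV. \<nu> $ k * rad1 k u) = 1" "(\<Sum>k\<in>UNIV. \<nu> $ k *\<^sub>R ang1 k u) = 0"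
    using radial_field[OF assms(1)] .
  have L\<nu>: "?L \<nu> = (1, 0)"
    using \<nu> by (simp add: dphi_eq[OF assms(1)])
  have a: "a = (\<Sum>i\<in>UNIV. v $ i * rad1 i u)" and \<alpha>: "\<alpha> = (\<Sum>i\<in>UNIV. v $ i *\<^sub>R ang1 i u)"
    and b: "b = (\<Sum>i\<in>UNIV. w $ i * rad1 i u)" and \<beta>: "\<beta> = (\<Sum>i\<in>UNIV. w $ i *\<^sub>R ang1 i u)"
    using assms by (simp_all add: dphi_eq)
  have \<beta>\<beta>: "\<beta> \<bullet> \<beta> = (\<Sum>j\<in>UNIV. \<Sum>k\<in>UNIV. sph u j k * w $ j * w $ k)"
    unfolding \<beta> by (subst inner_sum_left) (simp add: inner_sum_right sph_def sum_distrib_left mult_ac)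
  have \<alpha>\<beta>: "\<alpha> \<bullet> \<beta> = (\<Sum>i\<in>UNIV. \<Sum>k\<in>UNIV. sph u i k * v $ i * w $ k)"
    unfolding \<alpha> \<beta> by (subst inner_sum_left) (simp add: inner_sum_right sph_def sum_distrib_left mult_ac)
  have bb: "b * b = (\<Sum>j\<in>UNIV. \<Sum>k\<in>UNIV. rad1 j u * rad1 k u * w $ j * w $ k)"
    unfolding b by (simp add: sum_product mult_ac)
  have ab: "a * b = (\<Sum>i\<in>UNIV. \<Sum>k\<in>UNIV. rad1 i u * rad1 k u * v $ i * w $ k)"
    unfolding a b by (simp add: sum_product mult_ac)
  have a\<beta>\<beta>: "(\<Sum>i\<in>UNIV. \<Sum>j\<in>UNIV. \<Sum>k\<in>UNIV. rad1 i u * sph u j k * v $ i * w $ j * w $ k) = a * (\<beta> \<bullet> \<beta>)"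
    unfolding a \<beta>\<beta> by (subst sum_distrib_right) (simp add: sum_distrib_left mult_ac)
  have b\<alpha>\<beta>: "(\<Sum>i\<in>UNIV. \<Sum>j\<in>UNIV. \<Sum>k\<in>UNIV. rad1 j u * sph u i k * v $ i * w $ j * w $ k) = b * (\<alpha> \<bullet> \<beta>)"
    unfolding b \<alpha>\<beta>
    by (subst sum.swap, subst sum_distrib_right) (simp add: sum_distrib_left mult_ac)
  define A where "A = radial_curv u * (h (rad u))\<^sup>2 - sph_curv u"
  define Q where "Q x y = sph_curv u * sph u x y + radial_curv u * rad1 x u * rad1 y u" for x y
  have Q\<beta>\<beta>: "(\<Sum>j\<in>UNIV. \<Sum>k\<in>UNIV. Q j k * w $ j * w $ k) = sph_curv u * (\<beta> \<bullet> \<beta>) + radial_curv u * (b * b)"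
    unfolding \<beta>\<beta> bb Q_def by (simp add: sum_distrib_left sum.distrib[symmetric] algebra_simps)
  have Q\<alpha>\<beta>: "(\<Sum>i\<in>UNIV. \<Sum>k\<in>UNIV. Q i k * v $ i * w $ k) = sph_curv u * (\<alpha> \<bullet> \<beta>) + radial_curv u * (a * b)"
    unfolding \<alpha>\<beta> ab Q_def by (simp add: sum_distrib_left sum.distrib[symmetric] algebra_simps)
  \<comment> \<open>R(v, w)w is expanded in \<open>\<nu>\<close>, \<open>v\<close> and
    \<open>w\<close>, whose images under the derivative of the chart are known. The coefficients are
    \<open>riemann_eq\<close> contracted with the radial and angular parts of the two
    vectors.\<close>
  have "riemann_op G u v w w $ l = A * (a * (\<beta> \<bullet> \<beta>) - b * (\<alpha> \<bullet> \<beta>)) * \<nu> $ l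
      + (sph_curv u * (\<beta> \<bullet> \<beta>) + radial_curv u * (b * b)) * v $ l
      - (sph_curv u * (\<alpha> \<bullet> \<beta>) + radial_curv u * (a * b)) * w $ l" for l
  proof -
    have di: "(\<Sum>i\<in>UNIV. \<Sum>j\<in>UNIV. \<Sum>k\<in>UNIV. Q j k * (if l = i then 1 else 0) * v $ i * w $ j * w $ k) =
        (\<Sum>j\<in>UNIV. \<Sum>k\<in>UNIV. Q j k * w $ j * w $ k) * v $ l"
    proof -
      have "(\<Sum>i\<in>UNIV. \<Sum>j\<in>UNIV. \<Sum>k\<in>UNIV. Q j k * (if l = i then 1 else 0) * v $ i * w $ j * w $ k) =
          (\<Sum>i\<in>UNIV. if l = i then \<Sum>j\<in>UNIV. \<Sum>k\<in>UNIV. Q j k * v $ i * w $ j * w $ k else 0)"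
        by (intro sum.cong refl) auto
      then show ?thesis by (simp add: sum_distrib_left mult_ac)
    qed
    have dj: "(\<Sum>i\<in>UNIV. \<Sum>j\<in>UNIV. \<Sum>k\<in>UNIV. Q i k * (if l = j then 1 else 0) * v $ i * w $ j * w $ k) =
        (\<Sum>i\<in>UNIV. \<Sum>k\<in>UNIV. Q i k * v $ i * w $ k) * w $ l"
    proof -
      have "(\<Sum>i\<in>UNIV. \<Sum>j\<in>UNIV. \<Sum>k\<in>UNIV. Q i k * (if l = j then 1 else 0) * v $ i * w $ j * w $ k) =
          (\<Sum>i\<in>UNIV. \<Sum>j\<in>UNIV. if l = j then \<Sum>k\<in>UNIV. Q i k * v $ i * w $ j * w $ k else 0)"
        by (intro sum.cong refl) auto
      then show ?thesis by (simp add: sum_distrib_left mult_ac)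
    qed
    have "riemann_op G u v w w $ l = (\<Sum>i\<in>UNIV. \<Sum>j\<in>UNIV. \<Sum>k\<in>UNIV.
        A * \<nu> $ l * (rad1 i u * sph u j k * v $ i * w $ j * w $ k)
        - A * \<nu> $ l * (rad1 j u * sph u i k * v $ i * w $ j * w $ k)
        + Q j k * (if l = i then 1 else 0) * v $ i * w $ j * w $ k
        - Q i k * (if l = j then 1 else 0) * v $ i * w $ j * w $ k)"
      unfolding riemann_op_def riemann_eq[OF assms(1) \<nu>] A_def[symmetric] Q_def[symmetric]
      by (simp add: algebra_simps del: mult_if_delta)
    also have "\<dots> = A * \<nu> $ l * (a * (\<beta> \<bullet> \<beta>)) - A * \<nu> $ l * (b * (\<alpha> \<bullet> \<beta>))
        + (\<Sum>j\<in>UNIV. \<Sum>k\<in>UNIV. Q j k * w $ j * w $ k) * v $ l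
        - (\<Sum>i\<in>UNIV. \<Sum>k\<in>UNIV. Q i k * v $ i * w $ k) * w $ l"
      unfolding a\<beta>\<beta>[symmetric] b\<alpha>\<beta>[symmetric] di[symmetric] dj[symmetric]
      by (simp only: sum.distrib sum_subtractf sum_distrib_left)
    finally show ?thesis
      unfolding Q\<beta>\<beta> Q\<alpha>\<beta> by (simp add: algebra_simps)
  qed
  then have op: "riemann_op G u v w w = (A * (a * (\<beta> \<bullet> \<beta>) - b * (\<alpha> \<bullet> \<beta>))) *\<^sub>R \<nu>
      + (sph_curv u * (\<beta> \<bullet> \<beta>) + radial_curv u * (b * b)) *\<^sub>R v
      - (sph_curv u * (\<alpha> \<bullet> \<beta>) + radial_curv u * (a * b)) *\<^sub>R w"
    by (simp add: vec_eq_iff)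
  note L = linear_dphi[OF assms(1)]
  show ?thesis
    unfolding op
    by (simp add: linear_add[OF L] linear_diff[OF L] linear_scale[OF L] assms(2,3) L\<nu> A_def
        algebra_simps)
qed

text \<open>The curvature is a weighted mean of \<open>radial_curv\<close> and
  \<open>sph_curv\<close> / h^2, with weights P and h^2 Q. Here Q is the Gram determinant of the
  angular parts and P measures how the radial direction enters the plane; linear independence
  prevents both from vanishing.\<close>

lemma sectional_curvature_positive:
  assumes u: "u \<in> U" and pos: "radial_curv u > 0" "sph_curv u > 0"
    and vw: "v \<noteq> w" "independent {v, w}"
  shows "sectional_curvature G u v w > 0"
proof -
  let ?L = "frechet_derivative \<phi> (at u)"
  obtain a \<alpha> where v: "?L v = (a, \<alpha>)" by fastforce
  obtain b \<beta> where w: "?L w = (b, \<beta>)" by fastforce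
  define P where "P = (a *\<^sub>R \<beta> - b *\<^sub>R \<alpha>) \<bullet> (a *\<^sub>R \<beta> - b *\<^sub>R \<alpha>)"
  define Q where "Q = (\<alpha> \<bullet> \<alpha>) * (\<beta> \<bullet> \<beta>) - (\<alpha> \<bullet> \<beta>)\<^sup>2"
  define H where "H = h (rad u)"
  have H: "H > 0" unfolding H_def by (rule h_rad_pos[OF u])
  have "P \<ge> 0" by (simp add: P_def)
  have "Q \<ge> 0" using Cauchy_Schwarz_ineq[of \<alpha> \<beta>] by (simp add: Q_def)
  have dep: "c = 0 \<and> d = 0" if "c *\<^sub>R ?L v = d *\<^sub>R ?L w" for c d
  proof -
    have "?L (c *\<^sub>R v) = ?L (d *\<^sub>R w)"
      using that linear_dphi[OF u] by (simp add: linear_scale)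
    then have "c *\<^sub>R v = d *\<^sub>R w"
      using inj_phi[OF u] by (simp add: inj_eq)
    then show ?thesis
      by (rule independent_pair_coeffs[OF vw(2,1)])
  qed
  have "P > 0 \<or> Q > 0"
  proof (rule ccontr)
    assume "\<not> ?thesis"
    with \<open>P \<ge> 0\<close> \<open>Q \<ge> 0\<close> have "P = 0" "Q = 0" by auto
    have "a *\<^sub>R \<beta> = b *\<^sub>R \<alpha>"
      using \<open>P = 0\<close> by (simp add: P_def)
    \<comment> \<open>\<open>b *\<^sub>R ?L v\<close> and \<open>a *\<^sub>R ?L w\<close> both have
      radial entry a b, and P = 0 equates their angular entries, so independence applies.\<close>
    then have "a = 0" "b = 0"
      using dep[of b a] by (auto simp: v w mult.commute)
    \<comment> \<open>The equality case of Cauchy-Schwarz: up to the factor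
      \<open>\<beta> \<bullet> \<beta>\<close>, this vector is the part of \<open>\<alpha>\<close>
      orthogonal to \<open>\<beta>\<close>.\<close>
    have "((\<beta> \<bullet> \<beta>) *\<^sub>R \<alpha> - (\<alpha> \<bullet> \<beta>) *\<^sub>R \<beta>) \<bullet> ((\<beta> \<bullet> \<beta>) *\<^sub>R \<alpha> - (\<alpha> \<bullet> \<beta>) *\<^sub>R \<beta>) = (\<beta> \<bullet> \<beta>) * Q"
      by (simp add: Q_def inner_diff_left inner_diff_right inner_commute[of \<beta> \<alpha>] power2_eq_square
          algebra_simps)
    then have "(\<beta> \<bullet> \<beta>) *\<^sub>R \<alpha> = (\<alpha> \<bullet> \<beta>) *\<^sub>R \<beta>"
      using \<open>Q = 0\<close> by simp
    then have "\<beta> \<bullet> \<beta> = 0"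
      using dep[of "\<beta> \<bullet> \<beta>" "\<alpha> \<bullet> \<beta>"] \<open>a = 0\<close> \<open>b = 0\<close> by (simp add: v w)
    then show False
      using dep[of 0 1] \<open>b = 0\<close> by (simp add: v w zero_prod_def)
  qed
  have den: "metric_inner G u v v * metric_inner G u w w - (metric_inner G u v w)\<^sup>2 = H\<^sup>2 * (P + H\<^sup>2 * Q)"
    unfolding metric_inner_eq[OF u] v w warped_metric_def rad_def[symmetric] H_def[symmetric] P_def Q_def
    by (simp add: inner_diff_left inner_diff_right inner_commute[of \<beta> \<alpha>] power2_eq_square algebra_simps)
  have num: "metric_inner G u (riemann_op G u v w w) v = H\<^sup>2 * (radial_curv u * P + sph_curv u * Q)"
    unfolding metric_inner_eq[OF u] dphi_riemann_op[OF u v w] v warped_metric_def rad_def[symmetric]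
      H_def[symmetric] P_def Q_def
    by (simp add: inner_diff_left inner_diff_right inner_add_left inner_commute[of \<beta> \<alpha>]
        power2_eq_square algebra_simps)
  have "P + H\<^sup>2 * Q > 0" "radial_curv u * P + sph_curv u * Q > 0"
    using \<open>P > 0 \<or> Q > 0\<close> \<open>P \<ge> 0\<close> \<open>Q \<ge> 0\<close> H pos
    by (auto intro: add_pos_nonneg add_nonneg_pos)
  then show ?thesis
    unfolding sectional_curvature_def den num using H by simp
qed

end

section \<open>Warped products over the sphere\<close>

lemma warped_metric_bilinear: "bilinear (warped_metric h p)"
  unfolding bilinear_def warped_metric_def
  by (auto intro!: linearI simp: algebra_simps inner_add_left inner_add_right)

lemma bilinear_compose_linear:
  assumes "bilinear B" "linear L"
  shows "bilinear (\<lambda>v w. B (L v) (L w))"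
  using assms linear_compose[OF assms(2)] unfolding bilinear_def o_def by blast

lemma smooth_on_norm:
  fixes S :: "'a::euclidean_space set"
  assumes "open S" "0 \<notin> S"
  shows "smooth_on S norm"
proof -
  have "smooth_on S (\<lambda>x. sqrt (x \<bullet> x))"
  proof (rule smooth_on_compose[OF assms(1) smooth_on_sqrt])
    show "smooth_on S (\<lambda>x. x \<bullet> x)"
      by (intro smooth_on_inner smooth_on_ident assms)
    show "(\<lambda>x. x \<bullet> x) ` S \<subseteq> {0<..}"
      using assms(2) by auto
  qed
  then show ?thesis by (simp add: norm_eq_sqrt_inner[abs_def])
qed

lemma polar_has_derivative:
  "(polar has_derivative (\<lambda>v. fst v *\<^sub>R snd p + fst p *\<^sub>R snd v)) (at p)"
  unfolding polar_def[abs_def]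
  by (auto intro!: derivative_eq_intros)

text \<open>A single chart suffices: the inverse of polar coordinates on the shell of points whose
  norm lies in \<open>I\<close>. The shell avoids the origin, so the norm is smooth there.\<close>

lemma smooth_submanifold_interval_times_sphere:
  fixes I :: "real set"
  assumes I: "open I" "I \<subseteq> {0<..}"
  shows "smooth_submanifold TYPE('n) (I \<times> (sphere 0 1 :: (real^'n::finite) set))"
proof -
  define U :: "(real^'n) set" where "U = norm -` I"
  define \<phi> where "\<phi> u = (norm u, inverse (norm u) *\<^sub>R u)" for u :: "real^'n"
  have norm_pos: "norm u > 0" if "u \<in> U" for u
    using that I by (auto simp: U_def)
  then have "0 \<notin> U" by force
  have "open U"
    unfolding U_def by (rule open_vimage[OF I(1)]) (intro continuous_intros)
  have smooth: "smooth_on U \<phi>"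
    unfolding \<phi>_def
    by (intro smooth_on_Pair smooth_on_scaleR smooth_on_norm smooth_on_ident
        smooth_on_compose[OF _ smooth_on_inverse] \<open>open U\<close> \<open>0 \<notin> U\<close>) (use norm_pos in auto)
  have polar_phi: "polar (\<phi> u) = u" if "u \<in> U" for u
    using norm_pos[OF that] by (simp add: polar_def \<phi>_def)
  have phi_polar: "\<phi> (polar p) = p" if "p \<in> I \<times> sphere 0 1" for p
  proof -
    have "fst p > 0" "norm (snd p) = 1" using that I by auto
    then show ?thesis by (simp add: \<phi>_def polar_def prod_eq_iff)
  qed
  have polar_in: "polar p \<in> U" if "p \<in> I \<times> sphere 0 1" for p
    using that I by (auto simp: U_def polar_def)
  have phi_in: "\<phi> u \<in> I \<times> sphere 0 1" if "u \<in> U" for u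
    using that norm_pos[OF that] by (simp add: \<phi>_def U_def)
  have image: "\<phi> ` U = I \<times> sphere 0 1"
  proof
    show "\<phi> ` U \<subseteq> I \<times> sphere 0 1" using phi_in by blast
    show "I \<times> sphere 0 1 \<subseteq> \<phi> ` U"
      by (rule subsetI, rule image_eqI[where f = \<phi>, OF phi_polar[symmetric] polar_in])
  qed
  have inj: "inj (frechet_derivative \<phi> (at u))" if "u \<in> U" for u
  proof -
    let ?L = "frechet_derivative \<phi> (at u)"
    have "((polar \<circ> \<phi>) has_derivative
        (\<lambda>v. fst v *\<^sub>R snd (\<phi> u) + fst (\<phi> u) *\<^sub>R snd v) \<circ> ?L) (at u)"
      by (rule diff_chain_at[OF smooth_on_has_derivative[OF smooth that] polar_has_derivative])
    moreover have "((polar \<circ> \<phi>) has_derivative (\<lambda>v. v)) (at u)"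
      by (rule has_derivative_transform_within_open[OF has_derivative_ident \<open>open U\<close> that])
        (simp add: polar_phi)
    \<comment> \<open>The chain rule for \<open>polar \<circ> \<phi>\<close>, which is the identity
      on \<open>U\<close>, exhibits a left inverse of the derivative.\<close>
    ultimately have "(\<lambda>v. fst v *\<^sub>R snd (\<phi> u) + fst (\<phi> u) *\<^sub>R snd v) \<circ> ?L = (\<lambda>v. v)"
      by (rule has_derivative_unique)
    then show ?thesis
      by (metis (no_types, lifting) comp_apply injI)
  qed
  have "homeomorphism U (\<phi> ` U) \<phi> polar"
    unfolding homeomorphism_def
  proof (intro conjI ballI)
    show "continuous_on U \<phi>" by (rule smooth_on_continuous_on[OF smooth])
    show "continuous_on (\<phi> ` U) polar"
      unfolding polar_def by (intro continuous_intros)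
    show "polar ` \<phi> ` U = U" using polar_phi by force
  qed (use polar_phi phi_polar image in auto)
  then have "local_param (I \<times> sphere 0 1) U \<phi>"
    unfolding local_param_def using \<open>open U\<close> smooth inj image by auto
  then show ?thesis
    unfolding smooth_submanifold_def using image by blast
qed

locale warping_function =
  fixes I :: "real set" and h h' h'' :: "real \<Rightarrow> real"
  assumes open_I: "open I" and I_pos: "I \<subseteq> {0<..}"
    and smooth_h: "smooth_on I h"
    and h_pos: "t \<in> I \<Longrightarrow> h t > 0"
    and h_deriv: "t \<in> I \<Longrightarrow> (h has_real_derivative h' t) (at t)"
    and h'_deriv: "t \<in> I \<Longrightarrow> (h' has_real_derivative h'' t) (at t)"
begin

lemma warped_chart:
  assumes "local_param (I \<times> sphere 0 1) U \<phi>"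
  shows "warped_chart U \<phi> I h h' h''"
proof -
  have "\<phi> ` U \<subseteq> I \<times> sphere 0 1"
    using assms unfolding local_param_def by (blast dest: openin_imp_subset)
  then show ?thesis
    using assms smooth_h h_pos h_deriv h'_deriv
    by unfold_locales (auto simp: local_param_def)
qed

lemma riemannian_manifold_warped:
  "riemannian_manifold TYPE('n) (I \<times> (sphere 0 1 :: (real^'n::finite) set)) (warped_metric h)"
  unfolding riemannian_manifold_def
proof (intro conjI allI impI ballI)
  show "smooth_submanifold TYPE('n) (I \<times> (sphere 0 1 :: (real^'n) set))"
    by (rule smooth_submanifold_interval_times_sphere[OF open_I I_pos])
next
  fix U :: "(real^'n) set" and \<phi> :: "real^'n \<Rightarrow> real \<times> (real^'n)" and u
  assume "local_param (I \<times> sphere 0 1) U \<phi>" and u: "u \<in> U"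
  then interpret warped_chart U \<phi> I h h' h''
    by (intro warped_chart)
  show "bilinear (pullback \<phi> (warped_metric h) u)"
    using bilinear_compose_linear[OF warped_metric_bilinear linear_dphi[OF u]]
    unfolding pullback_def[abs_def] .
  show "pullback \<phi> (warped_metric h) u v w = pullback \<phi> (warped_metric h) u w v" for v w
    by (simp add: pullback_def warped_metric_def inner_commute mult.commute)
  show "pullback \<phi> (warped_metric h) u v v > 0" if "v \<noteq> 0" for v
    using metric_inner_pos[OF u that] by (simp add: metric_inner_eq[OF u] pullback_def)
next
  fix U :: "(real^'n) set" and \<phi> :: "real^'n \<Rightarrow> real \<times> (real^'n)" and v w
  assume "local_param (I \<times> sphere 0 1) U \<phi>"
  then interpret warped_chart U \<phi> I h h' h''
    by (rule warped_chart)
  show "smooth_on U (\<lambda>u. pullback \<phi> (warped_metric h) u v w)"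
    unfolding pullback_def warped_metric_def
    by (intro smooth_on_add smooth_on_mult smooth_on_power smooth_on_inner smooth_on_fst smooth_on_snd
        smooth_on_frechet_derivative smooth_phi open_U smooth_on_compose[OF _ smooth_h])
      (use phi_image in auto)
qed

lemma smooth_function_radial:
  assumes "smooth_on I f"
  shows "smooth_function TYPE('n) (I \<times> (sphere 0 1 :: (real^'n::finite) set)) (\<lambda>p. f (fst p))"
  unfolding smooth_function_def
proof (intro allI impI)
  fix U :: "(real^'n) set" and \<phi> :: "real^'n \<Rightarrow> real \<times> (real^'n)"
  assume "local_param (I \<times> sphere 0 1) U \<phi>"
  then interpret warped_chart U \<phi> I h h' h''
    by (rule warped_chart)
  show "smooth_on U ((\<lambda>p. f (fst p)) \<circ> \<phi>)"
    unfolding o_def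
    by (rule smooth_on_compose[OF open_U assms smooth_on_fst[OF open_U smooth_phi]])
      (use phi_image in auto)
qed

lemma positive_sectional_curvature_warped:
  assumes "\<And>t. t \<in> I \<Longrightarrow> h'' t < 0" "\<And>t. t \<in> I \<Longrightarrow> (h' t)\<^sup>2 < 1"
  shows "positive_sectional_curvature TYPE('n) (I \<times> (sphere 0 1 :: (real^'n::finite) set)) (warped_metric h)"
  unfolding positive_sectional_curvature_def
proof (intro allI impI ballI, elim conjE)
  fix U :: "(real^'n) set" and \<phi> :: "real^'n \<Rightarrow> real \<times> (real^'n)" and u v w :: "real^'n"
  assume "local_param (I \<times> sphere 0 1) U \<phi>" and u: "u \<in> U" and vw: "v \<noteq> w" "independent {v, w}"
  then interpret warped_chart U \<phi> I h h' h''
    by (intro warped_chart)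
  show "sectional_curvature (metric_matrix \<phi> (warped_metric h)) u v w > 0"
    using assms rad_in_I[OF u] h_rad_pos[OF u]
    by (intro sectional_curvature_positive[OF u _ _ vw])
      (simp_all add: radial_curv_def sph_curv_def divide_neg_pos)
qed

text \<open>
  The hypothesis \<open>ode\<close> is the vanishing of the traceless part of \<open>f Ric - \<nabla>\<^sup>2f\<close>; the two remaining
  equations then define \<open>\<mu>\<close> and \<open>\<rho>\<close>.
\<close>

lemma static_perfect_fluid_space_warped:
  fixes f f' f'' \<mu> \<rho> :: "real \<Rightarrow> real"
  assumes n: "CARD('n::finite) \<ge> 2"
    and smooth: "smooth_on I f" "smooth_on I \<mu>" "smooth_on I \<rho>"
    and f_pos: "\<And>t. t \<in> I \<Longrightarrow> f t > 0"
    and f: "\<And>t. t \<in> I \<Longrightarrow> (f has_real_derivative f' t) (at t)"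
    and f': "\<And>t. t \<in> I \<Longrightarrow> (f' has_real_derivative f'' t) (at t)"
    and ode: "\<And>t. t \<in> I \<Longrightarrow> f'' t - h' t / h t * f' t =
      - (real CARD('n) - 2) * (h'' t / h t + (1 - (h' t)\<^sup>2) / (h t)\<^sup>2) * f t"
    and \<mu>: "\<And>t. t \<in> I \<Longrightarrow> \<mu> t = (real CARD('n) - 1) / 2 *
      ((real CARD('n) - 2) * ((1 - (h' t)\<^sup>2) / (h t)\<^sup>2) - 2 * (h'' t / h t))"
    and \<rho>: "\<And>t. t \<in> I \<Longrightarrow> ((real CARD('n) - 2) * \<mu> t + real CARD('n) * \<rho> t) / (real CARD('n) - 1) * f t =
      f'' t + (real CARD('n) - 1) * (h' t / h t) * f' t"
  shows "static_perfect_fluid_space TYPE('n) (I \<times> (sphere 0 1 :: (real^'n) set)) (warped_metric h)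
    (\<lambda>p. f (fst p)) (\<lambda>p. \<rho> (fst p)) (\<lambda>p. \<mu> (fst p))"
  unfolding static_perfect_fluid_space_def Let_def
proof (intro conjI allI impI ballI)
  fix U :: "(real^'n) set" and \<phi> :: "real^'n \<Rightarrow> real \<times> (real^'n)" and u i j
  assume "local_param (I \<times> sphere 0 1) U \<phi>" and u: "u \<in> U"
  then interpret warped_chart U \<phi> I h h' h''
    by (intro warped_chart)
  define t where "t = rad u"
  have t: "t \<in> I" "fst (\<phi> u) = t"
    using rad_in_I[OF u] by (simp_all add: t_def rad_def)
  have comp: "(\<lambda>p. f (fst p)) \<circ> \<phi> = (\<lambda>x. f (rad x))"
    by (simp add: fun_eq_iff rad_def)
  have ht: "h t > 0" using h_pos[OF t(1)] .
  show lap: "laplacian G ((\<lambda>p. f (fst p)) \<circ> \<phi>) u =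
      ((real CARD('n) - 2) * \<mu> (fst (\<phi> u)) + real CARD('n) * \<rho> (fst (\<phi> u))) / (real CARD('n) - 1) * f (fst (\<phi> u))"
    unfolding comp t(2) \<rho>[OF t(1)] using laplacian_radial[OF f f' u] by (simp add: t_def)
  show scal: "\<mu> (fst (\<phi> u)) = scalar_curvature G u / 2"
    unfolding t(2) \<mu>[OF t(1)] scalar_curvature_eq[OF u] radial_curv_def sph_curv_def t_def[symmetric]
    by (simp add: field_simps)
  define N where "N = real CARD('n)"
  have N: "N \<ge> 2" using n by (simp add: N_def)
  \<comment> \<open>\<open>K\<close> is the curvature of planes orthogonal to the radial field,
    \<open>- k\<close> that of planes containing it.\<close>
  define K where "K = (1 - (h' t)\<^sup>2) / (h t)\<^sup>2"
  define k where "k = h'' t / h t"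
  define q where "q = h' t / h t"
  have ode': "f'' t = q * f' t - (N - 2) * (k + K) * f t"
    using ode[OF t(1)] unfolding N_def K_def k_def q_def mult_minus_left by linarith
  have \<mu>': "\<mu> t = (N - 1) / 2 * ((N - 2) * K - 2 * k)"
    using \<mu>[OF t(1)] by (simp add: N_def K_def k_def)
  have "((N - 2) * \<mu> t + N * \<rho> t) * f t = (N - 1) * (f'' t + (N - 1) * q * f' t)"
    using \<rho>[OF t(1)] N by (simp add: N_def[symmetric] q_def field_simps)
  then have "N * (\<rho> t * f t) = (N - 1) * (f'' t + (N - 1) * q * f' t) - (N - 2) * \<mu> t * f t"
    by (simp add: algebra_simps)
  also have "\<dots> = N * ((N - 1) * q * f' t - (N - 1) * (N - 2) * K / 2 * f t)"
    unfolding ode' \<mu>' by (simp add: field_simps)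
  finally have \<rho>': "\<rho> t * f t = (N - 1) * q * f' t - (N - 1) * (N - 2) * K / 2 * f t"
    using N by simp
  \<comment> \<open>This coefficient of the metric is what the spherical component of the tensor
    equation demands; with it the radial component becomes exactly \<open>ode'\<close>.\<close>
  have coeff: "(\<mu> t - \<rho> t) / (N - 1) * f t = ((N - 2) * K - k) * f t - q * f' t"
  proof -
    have "(\<mu> t - \<rho> t) * f t = (N - 1) * (((N - 2) * K - k) * f t - q * f' t)"
      unfolding left_diff_distrib \<rho>' \<mu>' by (simp add: field_simps)
    then show ?thesis using N by (simp add: field_simps)
  qed
  have G: "G u $ i $ j = rad1 i u * rad1 j u + (h t)\<^sup>2 * sph u i j"
    using G_eq[OF u] by (simp add: t_def)
  have ric: "ricci G u i j = - (N - 1) * k * rad1 i u * rad1 j u + (h t)\<^sup>2 * ((N - 2) * K - k) * sph u i j"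
    unfolding ricci_eq[OF u] radial_curv_def sph_curv_def t_def[symmetric] N_def[symmetric] K_def k_def
    using ht by (simp add: field_simps power2_eq_square)
  have hess: "hessian G ((\<lambda>p. f (fst p)) \<circ> \<phi>) u i j =
      f'' t * rad1 i u * rad1 j u + (h t)\<^sup>2 * (q * f' t) * sph u i j"
    unfolding comp using hessian_radial[OF f f' u, of i j] ht
    by (simp add: t_def q_def power2_eq_square)
  show "f (fst (\<phi> u)) * ricci G u i j = hessian G ((\<lambda>p. f (fst p)) \<circ> \<phi>) u i j
      + (\<mu> (fst (\<phi> u)) - \<rho> (fst (\<phi> u))) / (real CARD('n) - 1) * f (fst (\<phi> u)) * G u $ i $ j"
    unfolding t(2) N_def[symmetric] coeff G ric hess ode' by (simp add: algebra_simps)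
qed (use riemannian_manifold_warped smooth_function_radial smooth f_pos in auto)

end

section \<open>Smooth extension through the origin\<close>

text \<open>
  The power series of \<open>cosh \<surd>s\<close>, of \<open>sinh \<surd>s / \<surd>s\<close> and of their difference divided by \<open>s\<close>.
\<close>

definition cosh_sqrt :: "real \<Rightarrow> real" where
  "cosh_sqrt s = (\<Sum>n. (1 / fact (2 * n)) * s ^ n)"

definition sinhc_sqrt :: "real \<Rightarrow> real" where
  "sinhc_sqrt s = (\<Sum>n. (1 / fact (2 * n + 1)) * s ^ n)"

definition cosh_sinhc_quot :: "real \<Rightarrow> real" where
  "cosh_sinhc_quot s = (\<Sum>n. (1 / fact (2 * n + 2) - 1 / fact (2 * n + 3)) * s ^ n)"

lemma summable_inverse_fact_power:
  assumes "\<And>n. n \<le> m n"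
  shows "summable (\<lambda>n. (1 / fact (m n)) * x ^ n :: real)"
proof (rule summable_comparison_test)
  show "summable (\<lambda>n. inverse (fact n) * \<bar>x\<bar> ^ n :: real)"
    by (rule summable_exp)
  have "(1 / fact (m n)) * \<bar>x\<bar> ^ n \<le> inverse (fact n) * \<bar>x\<bar> ^ n" for n
    unfolding inverse_eq_divide
    by (intro mult_right_mono divide_left_mono fact_mono assms) auto
  then show "\<exists>N. \<forall>n\<ge>N. norm ((1 / fact (m n)) * x ^ n) \<le> inverse (fact n) * \<bar>x\<bar> ^ n"
    by (auto simp: abs_mult power_abs)
qed

lemma summable_cosh_sqrt: "summable (\<lambda>n. (1 / fact (2 * n)) * x ^ n :: real)"
  and summable_sinhc_sqrt: "summable (\<lambda>n. (1 / fact (2 * n + 1)) * x ^ n :: real)"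
  by (rule summable_inverse_fact_power; simp)+

lemma summable_cosh_sinhc_quot:
  "summable (\<lambda>n. (1 / fact (2 * n + 2) - 1 / fact (2 * n + 3)) * x ^ n :: real)"
  unfolding left_diff_distrib by (intro summable_diff summable_inverse_fact_power) auto

lemma smooth_cosh_sqrt: "smooth_on UNIV cosh_sqrt"
  unfolding cosh_sqrt_def[abs_def] by (rule smooth_on_powser[OF summable_cosh_sqrt])

lemma smooth_sinhc_sqrt: "smooth_on UNIV sinhc_sqrt"
  unfolding sinhc_sqrt_def[abs_def] by (rule smooth_on_powser[OF summable_sinhc_sqrt])

lemma smooth_cosh_sinhc_quot: "smooth_on UNIV cosh_sinhc_quot"
  unfolding cosh_sinhc_quot_def[abs_def] by (rule smooth_on_powser[OF summable_cosh_sinhc_quot])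

lemma cosh_sqrt_pos: "s \<ge> 0 \<Longrightarrow> cosh_sqrt s > 0"
  unfolding cosh_sqrt_def
  by (rule suminf_pos2[OF summable_cosh_sqrt, where i = 0]) auto

lemma sinhc_sqrt_pos: "s \<ge> 0 \<Longrightarrow> sinhc_sqrt s > 0"
  unfolding sinhc_sqrt_def
  by (rule suminf_pos2[OF summable_sinhc_sqrt, where i = 0]) auto

lemma cosh_sinhc_quot_nonneg: "s \<ge> 0 \<Longrightarrow> cosh_sinhc_quot s \<ge> 0"
  unfolding cosh_sinhc_quot_def
  by (intro suminf_nonneg[OF summable_cosh_sinhc_quot] mult_nonneg_nonneg)
    (auto intro!: divide_left_mono fact_mono simp del: fact_Suc)

lemma cosh_sqrt_square: "cosh_sqrt (r\<^sup>2) = cosh r"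
proof -
  have "(\<lambda>n. if even n then r ^ n /\<^sub>R fact n else 0) sums cosh r"
    by (rule cosh_converges)
  \<comment> \<open>The odd terms vanish, so the sum may be taken along the strictly increasing
    indices 2n.\<close>
  then have "(\<lambda>n. if even (2 * n) then r ^ (2 * n) /\<^sub>R fact (2 * n) else 0) sums cosh r"
    by (subst sums_mono_reindex[of "\<lambda>n. 2 * n"]) (auto simp: strict_mono_def elim!: evenE)
  then have "(\<lambda>n. (1 / fact (2 * n)) * (r\<^sup>2) ^ n) sums cosh r"
    by (simp add: power_mult divide_inverse)
  then show ?thesis
    unfolding cosh_sqrt_def by (rule sums_unique[symmetric])
qed

lemma sinhc_sqrt_square: "r * sinhc_sqrt (r\<^sup>2) = sinh r"
proof -
  have "(\<lambda>n. if even n then 0 else r ^ n /\<^sub>R fact n) sums sinh r"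
    by (rule sinh_converges)
  then have "(\<lambda>n. if even (2 * n + 1) then 0 else r ^ (2 * n + 1) /\<^sub>R fact (2 * n + 1)) sums sinh r"
    by (subst sums_mono_reindex[of "\<lambda>n. 2 * n + 1"]) (auto simp: strict_mono_def elim!: oddE)
  then have "(\<lambda>n. r * ((1 / fact (2 * n + 1)) * (r\<^sup>2) ^ n)) sums sinh r"
    by (simp add: power_mult divide_inverse mult_ac power2_eq_square power_mult_distrib del: fact_Suc)
  then have "(\<Sum>n. r * ((1 / fact (2 * n + 1)) * (r\<^sup>2) ^ n)) = sinh r"
    by (rule sums_unique[symmetric])
  then show ?thesis
    unfolding sinhc_sqrt_def using suminf_mult[OF summable_sinhc_sqrt, of r "r\<^sup>2"] by simp
qed

lemma cosh_sinhc_quot: "s * cosh_sinhc_quot s = cosh_sqrt s - sinhc_sqrt s"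
proof -
  let ?c = "\<lambda>n. (1 / fact (2 * n) - 1 / fact (2 * n + 1)) * s ^ n"
  have "cosh_sqrt s - sinhc_sqrt s = (\<Sum>n. ?c n)"
    unfolding cosh_sqrt_def sinhc_sqrt_def suminf_diff[OF summable_cosh_sqrt summable_sinhc_sqrt]
    by (simp add: left_diff_distrib)
  \<comment> \<open>The head \<open>?c 0\<close> is 1/0! - 1/1! = 0, which is why the difference is
    divisible by \<open>s\<close>.\<close>
  also have "\<dots> = (\<Sum>n. ?c (Suc n)) + ?c 0"
    using suminf_split_head[of ?c]
      summable_diff[OF summable_cosh_sqrt[of s] summable_sinhc_sqrt[of s]]
    by (simp add: left_diff_distrib)
  also have "(\<Sum>n. ?c (Suc n)) = (\<Sum>n. s * ((1 / fact (2 * n + 2) - 1 / fact (2 * n + 3)) * s ^ n))"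
    by (intro suminf_cong) (simp add: numeral_3_eq_3 mult_ac del: fact_Suc)
  also have "\<dots> = s * cosh_sinhc_quot s"
    unfolding cosh_sinhc_quot_def by (rule suminf_mult[OF summable_cosh_sinhc_quot])
  finally show ?thesis by simp
qed

text \<open>
  In polar coordinates \<open>x = r\<theta>\<close> the form \<open>a(|x|\<^sup>2) \<langle>v, w\<rangle> + b(|x|\<^sup>2) \<langle>x, v\<rangle>\<langle>x, w\<rangle>\<close> becomes
  \<open>(a + r\<^sup>2b) dr\<^sup>2 + r\<^sup>2a g\<^sub>S\<close>, so \<open>a = (tanh r / r)\<^sup>2\<close> and \<open>b = (1 - a) / r\<^sup>2\<close> are needed. Both are smooth in
  \<open>r\<^sup>2\<close>.
\<close>

definition tanh_metric :: "real^'n::finite \<Rightarrow> real^'n \<Rightarrow> real^'n \<Rightarrow> real" where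
  "tanh_metric x v w = (sinhc_sqrt (x \<bullet> x))\<^sup>2 / (cosh_sqrt (x \<bullet> x))\<^sup>2 * (v \<bullet> w)
    + cosh_sinhc_quot (x \<bullet> x) * (cosh_sqrt (x \<bullet> x) + sinhc_sqrt (x \<bullet> x)) / (cosh_sqrt (x \<bullet> x))\<^sup>2
      * (x \<bullet> v) * (x \<bullet> w)"

lemma smooth_submanifold_UNIV: "smooth_submanifold TYPE('n::finite) (UNIV :: (real^'n) set)"
proof -
  have "homeomorphism UNIV (id ` UNIV) id (id :: real^'n \<Rightarrow> real^'n)"
    by (simp add: homeomorphism_def)
  then have "local_param UNIV UNIV (id :: real^'n \<Rightarrow> real^'n)"
    using smooth_on_ident[of "UNIV :: (real^'n) set"]
    by (auto simp: local_param_def id_def)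
  then show ?thesis
    unfolding smooth_submanifold_def by (metis UNIV_I id_apply imageI)
qed

text \<open>The coefficients depend smoothly on \<open>x \<bullet> x\<close>, which unlike the norm
  is smooth at the origin. Positivity holds since the coefficient of the Euclidean product is
  positive and that of the rank-one term is nonnegative, all arguments of the series being
  nonnegative.\<close>

lemma riemannian_manifold_tanh_metric:
  "riemannian_manifold TYPE('n::finite) (UNIV :: (real^'n) set) tanh_metric"
  unfolding riemannian_manifold_def
proof (intro conjI allI impI ballI)
  fix U :: "(real^'n) set" and \<phi> :: "real^'n \<Rightarrow> real^'n" and u
  assume \<phi>: "local_param UNIV U \<phi>" and u: "u \<in> U"
  let ?L = "frechet_derivative \<phi> (at u)"
  have smooth: "smooth_on U \<phi>" and inj: "inj ?L"
    using \<phi> u by (auto simp: local_param_def)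
  have L: "linear ?L"
    by (rule linear_frechet_derivative[OF smooth_on_differentiable[OF smooth u]])
  have "bilinear (\<lambda>v w. a * (v \<bullet> w) + b * (x \<bullet> v) * (x \<bullet> w))" for x :: "real^'n" and a b
    unfolding bilinear_def
    by (auto intro!: linearI simp: algebra_simps inner_add_left inner_add_right)
  then have "bilinear (tanh_metric x)" for x :: "real^'n"
    unfolding tanh_metric_def[abs_def] .
  from bilinear_compose_linear[OF this L]
  show "bilinear (pullback \<phi> tanh_metric u)"
    unfolding pullback_def[abs_def] .
  show "pullback \<phi> tanh_metric u v w = pullback \<phi> tanh_metric u w v" for v w
    by (simp add: pullback_def tanh_metric_def inner_commute)
  show "pullback \<phi> tanh_metric u v v > 0" if "v \<noteq> 0" for v
  proof -
    define x where "x = \<phi> u"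
    define y where "y = ?L v"
    have "y \<noteq> 0"
      using inj that linear_0[OF L] unfolding y_def by (metis injD)
    then have "(sinhc_sqrt (x \<bullet> x))\<^sup>2 / (cosh_sqrt (x \<bullet> x))\<^sup>2 * (y \<bullet> y) > 0"
      using sinhc_sqrt_pos[of "x \<bullet> x"] cosh_sqrt_pos[of "x \<bullet> x"] by simp
    moreover have "cosh_sinhc_quot (x \<bullet> x) * (cosh_sqrt (x \<bullet> x) + sinhc_sqrt (x \<bullet> x))
        / (cosh_sqrt (x \<bullet> x))\<^sup>2 * ((x \<bullet> y) * (x \<bullet> y)) \<ge> 0"
      using sinhc_sqrt_pos[of "x \<bullet> x"] cosh_sqrt_pos[of "x \<bullet> x"] cosh_sinhc_quot_nonneg[of "x \<bullet> x"]
      by (intro mult_nonneg_nonneg[OF _ zero_le_square] divide_nonneg_nonneg mult_nonneg_nonneg) auto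
    ultimately show ?thesis
      unfolding pullback_def tanh_metric_def x_def[symmetric] y_def[symmetric]
      by (simp add: mult.assoc)
  qed
next
  fix U :: "(real^'n) set" and \<phi> :: "real^'n \<Rightarrow> real^'n" and v w
  assume "local_param UNIV U \<phi>"
  then have U: "open U" and smooth: "smooth_on U \<phi>"
    by (auto simp: local_param_def)
  have comp: "smooth_on U (\<lambda>u. f (\<phi> u \<bullet> \<phi> u))" if "smooth_on UNIV f" for f :: "real \<Rightarrow> real"
    by (rule smooth_on_compose[OF U that]) (auto intro: smooth_on_inner U smooth)
  show "smooth_on U (\<lambda>u. pullback \<phi> tanh_metric u v w)"
    unfolding pullback_def tanh_metric_def
    by (intro smooth_on_add smooth_on_mult smooth_on_divide smooth_on_power smooth_on_inner U smooth
        smooth_on_frechet_derivative comp smooth_cosh_sqrt smooth_sinhc_sqrt smooth_cosh_sinhc_quot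
        zero_less_power cosh_sqrt_pos inner_ge_zero)
qed (rule smooth_submanifold_UNIV)

section \<open>Comparison with the warped metric in polar coordinates\<close>

lemma tangent_space_sphere_orthogonal:
  assumes "v \<in> tangent_space (A \<times> sphere 0 1) p"
  shows "snd v \<bullet> snd p = 0"
proof -
  from assms obtain \<epsilon> \<gamma> where "\<epsilon> > 0" and \<gamma>: "\<gamma> ` {-\<epsilon><..<\<epsilon>} \<subseteq> A \<times> sphere 0 1" "\<gamma> 0 = p"
    "(\<gamma> has_vector_derivative v) (at 0)"
    unfolding tangent_space_def by blast
  have d: "((\<lambda>t. snd (\<gamma> t)) has_derivative (\<lambda>t. snd (t *\<^sub>R v))) (at 0)"
    using has_derivative_snd[OF \<gamma>(3)[unfolded has_vector_derivative_def]] .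
  have "((\<lambda>t. snd (\<gamma> t) \<bullet> snd (\<gamma> t)) has_derivative
      (\<lambda>t. snd (\<gamma> 0) \<bullet> snd (t *\<^sub>R v) + snd (t *\<^sub>R v) \<bullet> snd (\<gamma> 0))) (at 0)"
    by (rule has_derivative_inner[OF d d])
  moreover have "((\<lambda>t. snd (\<gamma> t) \<bullet> snd (\<gamma> t)) has_derivative (\<lambda>t. 0)) (at 0)"
  proof (rule has_derivative_transform_within_open[OF has_derivative_const])
    show "open {-\<epsilon><..<\<epsilon>}" "0 \<in> {-\<epsilon><..<\<epsilon>}" using \<open>\<epsilon> > 0\<close> by auto
    fix t assume "t \<in> {-\<epsilon><..<\<epsilon>}"
    then have "norm (snd (\<gamma> t)) = 1" using \<gamma>(1) by (auto simp: image_subset_iff mem_Times_iff)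
    then show "1 = snd (\<gamma> t) \<bullet> snd (\<gamma> t)" by (simp add: dot_square_norm)
  qed
  ultimately have "(\<lambda>t. snd (\<gamma> 0) \<bullet> snd (t *\<^sub>R v) + snd (t *\<^sub>R v) \<bullet> snd (\<gamma> 0)) = (\<lambda>t. 0)"
    by (rule has_derivative_unique)
  from fun_cong[OF this, of 1] show ?thesis
    by (simp add: \<gamma>(2) inner_commute)
qed

lemma pullback_polar_tanh_metric:
  assumes "r > 0" "norm \<theta> = 1" "snd v \<bullet> \<theta> = 0" "snd w \<bullet> \<theta> = 0"
  shows "pullback polar tanh_metric (r, \<theta>) v w = warped_metric tanh (r, \<theta>) v w"
proof -
  have d: "frechet_derivative polar (at (r, \<theta>)) z = fst z *\<^sub>R \<theta> + r *\<^sub>R snd z" for z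
    using fun_cong[OF frechet_derivative_at[OF polar_has_derivative[of "(r, \<theta>)"]], of z] by simp
  define C where "C = cosh_sqrt (r\<^sup>2)"
  define S where "S = sinhc_sqrt (r\<^sup>2)"
  define D where "D = cosh_sinhc_quot (r\<^sup>2)"
  have "C > 0" by (simp add: C_def cosh_sqrt_pos)
  have D: "r\<^sup>2 * D = C - S"
    unfolding C_def S_def D_def by (rule cosh_sinhc_quot)
  have tanh: "tanh r = r * S / C"
    by (simp add: tanh_def C_def S_def cosh_sqrt_square sinhc_sqrt_square)
  have \<theta>: "\<theta> \<bullet> \<theta> = 1" using assms(2) by (simp add: dot_square_norm)
  have \<theta>v: "\<theta> \<bullet> snd v = 0" and \<theta>w: "\<theta> \<bullet> snd w = 0"
    using assms(3,4) by (simp_all add: inner_commute)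
  have "pullback polar tanh_metric (r, \<theta>) v w =
      S\<^sup>2 / C\<^sup>2 * (fst v * fst w + r\<^sup>2 * (snd v \<bullet> snd w)) + D * (C + S) / C\<^sup>2 * (r * fst v) * (r * fst w)"
    unfolding pullback_def d tanh_metric_def
    using \<theta> \<theta>v \<theta>w assms(3)
    by (simp add: polar_def inner_add_left inner_add_right C_def S_def D_def power2_eq_square
        mult_ac)
  also have "\<dots> = (S\<^sup>2 + (r\<^sup>2 * D) * (C + S)) / C\<^sup>2 * (fst v * fst w) + (r * S / C)\<^sup>2 * (snd v \<bullet> snd w)"
    using \<open>C > 0\<close> by (simp add: field_simps power2_eq_square)
  \<comment> \<open>With r^2 D = C - S the numerator is S^2 + (C - S)(C + S) = C^2; this explains
    the factor C + S in \<open>tanh_metric\<close>.\<close>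
  also have "(S\<^sup>2 + (r\<^sup>2 * D) * (C + S)) / C\<^sup>2 = 1"
    unfolding D using \<open>C > 0\<close> by (simp add: field_simps power2_eq_square)
  finally show ?thesis
    by (simp add: warped_metric_def tanh)
qed

lemma tanh_warped_metric_extends:
  "extends_smoothly_through_origin
    (warped_metric tanh :: real \<times> (real^'n::finite) \<Rightarrow> real \<times> (real^'n) \<Rightarrow> real \<times> (real^'n) \<Rightarrow> real)"
  unfolding extends_smoothly_through_origin_def
proof (intro exI[of _ tanh_metric] conjI riemannian_manifold_tanh_metric ballI)
  fix p v w :: "real \<times> (real^'n)"
  assume p: "p \<in> {0<..} \<times> sphere 0 1"
    and "v \<in> tangent_space ({0<..} \<times> sphere 0 1) p" "w \<in> tangent_space ({0<..} \<times> sphere 0 1) p"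
  then have "snd v \<bullet> snd p = 0" "snd w \<bullet> snd p = 0"
    by (auto dest: tangent_space_sphere_orthogonal)
  then show "pullback polar tanh_metric p v w = warped_metric tanh p v w"
    using pullback_polar_tanh_metric[of "fst p" "snd p" v w] p by auto
qed

section \<open>The hyperbolic tangent as warping function\<close>

lemma tanh_real_deriv: "(tanh has_real_derivative 1 - (tanh t)\<^sup>2) (at (t::real))"
  by (auto intro!: derivative_eq_intros)

lemma warping_function_tanh:
  assumes "open I" "I \<subseteq> {0<..}"
  shows "warping_function I tanh (\<lambda>t. 1 - (tanh t)\<^sup>2) (\<lambda>t. - 2 * tanh t * (1 - (tanh t)\<^sup>2))"
proof
  \<comment> \<open>The coefficients 0 and 1 present sinh and cosh as members of the span treated in
    \<open>smooth_on_cosh_sinh\<close>.\<close>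
  have "smooth_on UNIV (\<lambda>t::real. (0 * cosh t + 1 * sinh t) / (1 * cosh t + 0 * sinh t))"
    by (intro smooth_on_divide smooth_on_cosh_sinh) auto
  then show "smooth_on I tanh"
    by (auto simp: tanh_def[abs_def] intro: smooth_on_subset)
  show "tanh t > 0" if "t \<in> I" for t
    using that assms(2) by auto
  show "((\<lambda>t. 1 - (tanh t)\<^sup>2) has_real_derivative - 2 * tanh t * (1 - (tanh t)\<^sup>2)) (at t)" for t :: real
    by (auto intro!: derivative_eq_intros)
qed (use assms tanh_real_deriv in auto)

lemma smooth_on_oscillating_log_cosh:
  fixes A B c :: real
  shows "smooth_on UNIV (\<lambda>t. A * sin (c * ln (cosh t)) + B * cos (c * ln (cosh t)))"
proof (rule smooth_on_compose[OF open_UNIV smooth_on_sin_cos, where f = "\<lambda>t. c * ln (cosh t)"])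
  have "smooth_on UNIV (\<lambda>t::real. 1 * cosh t + 0 * sinh t)"
    by (rule smooth_on_cosh_sinh)
  then have "smooth_on UNIV (\<lambda>t::real. ln (cosh t))"
    by (intro smooth_on_compose[OF open_UNIV smooth_on_ln]) auto
  then show "smooth_on UNIV (\<lambda>t. c * ln (cosh t))"
    by (intro smooth_on_mult smooth_on_const) auto
qed auto

text \<open>Since log cosh has derivative tanh, the factor after \<open>c * tanh t\<close> is again
  of the original form, with -B and A in place of A and B. The lemma therefore also gives the second
  derivative.\<close>

lemma oscillating_log_cosh_deriv:
  "((\<lambda>t. A * sin (c * ln (cosh t)) + B * cos (c * ln (cosh t))) has_real_derivative
    c * tanh t * (A * cos (c * ln (cosh t)) - B * sin (c * ln (cosh t)))) (at t)"
  by (auto intro!: derivative_eq_intros simp: tanh_def field_simps)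

lemma static_perfect_fluid_space_tanh:
  fixes A B :: real and I :: "real set"
  defines "f \<equiv> (\<lambda>t. A * sin (sqrt (real CARD('n::finite) - 2) * ln (cosh t))
                     + B * cos (sqrt (real CARD('n) - 2) * ln (cosh t)))"
  assumes n: "CARD('n) \<ge> 3" and I: "open I" "I \<subseteq> {0<..}" and f_pos: "\<And>t. t \<in> I \<Longrightarrow> f t > 0"
  shows "\<exists>\<rho> \<mu>. static_perfect_fluid_space TYPE('n) (I \<times> (sphere 0 1 :: (real^'n) set))
    (warped_metric tanh) (\<lambda>p. f (fst p)) \<rho> \<mu>"
proof -
  interpret warping_function I tanh "\<lambda>t. 1 - (tanh t)\<^sup>2" "\<lambda>t. - 2 * tanh t * (1 - (tanh t)\<^sup>2)"
    by (rule warping_function_tanh[OF I])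
  define N where "N = real CARD('n)"
  have N: "N \<ge> 3" using n by (simp add: N_def)
  define c where "c = sqrt (N - 2)"
  have c2: "c * c = N - 2" using N by (simp add: c_def)
  define q where "q t = A * cos (c * ln (cosh t)) - B * sin (c * ln (cosh t))" for t
  have f: "f = (\<lambda>t. A * sin (c * ln (cosh t)) + B * cos (c * ln (cosh t)))"
    by (simp add: f_def c_def N_def)
  have q: "q = (\<lambda>t. (- B) * sin (c * ln (cosh t)) + A * cos (c * ln (cosh t)))"
    by (simp add: q_def fun_eq_iff)
  have f_deriv: "(f has_real_derivative c * tanh t * q t) (at t)" for t
    unfolding f q_def by (rule oscillating_log_cosh_deriv)
  have q_deriv: "(q has_real_derivative - c * tanh t * f t) (at t)" for t
    unfolding q f by (rule DERIV_cong[OF oscillating_log_cosh_deriv]) (simp add: algebra_simps)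
  have f'_deriv: "((\<lambda>t. c * tanh t * q t) has_real_derivative
      c * (1 - (tanh t)\<^sup>2) * q t - c * c * (tanh t)\<^sup>2 * f t) (at t)" for t
    by (auto intro!: derivative_eq_intros q_deriv simp: algebra_simps power2_eq_square)
  have smooth_f: "smooth_on I f" and smooth_q: "smooth_on I q"
    unfolding f q by (rule smooth_on_subset[OF smooth_on_oscillating_log_cosh subset_UNIV])+
  \<comment> \<open>Half the scalar curvature for radial curvature 2(1 - tanh^2) and spherical
    curvature 2 - tanh^2.\<close>
  define \<mu> where "\<mu> t = (N - 1) / 2 * ((N - 2) * (2 - (tanh t)\<^sup>2) + 4 * (1 - (tanh t)\<^sup>2))" for t :: real
  \<comment> \<open>The trace equation solved for the pressure, the Laplacian being N (1 - tanh^2) c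
    q - c^2 tanh^2 f; positivity of \<open>f\<close> permits the division.\<close>
  define \<rho> where "\<rho> t = ((N - 1) * (N * (1 - (tanh t)\<^sup>2) * c * q t / f t - c * c * (tanh t)\<^sup>2) - (N - 2) * \<mu> t) / N" for t
  have smooth_\<mu>: "smooth_on I \<mu>"
    unfolding \<mu>_def
    by (intro smooth_on_add smooth_on_mult smooth_on_diff smooth_on_power smooth_on_const smooth_h open_I)
  have smooth_\<rho>: "smooth_on I \<rho>"
    unfolding \<rho>_def
    by (intro smooth_on_divide smooth_on_mult smooth_on_diff smooth_on_power smooth_on_const smooth_h
        smooth_\<mu> smooth_q smooth_f open_I f_pos) (use N in auto)
  \<comment> \<open>The values of (1 - h'^2)/h^2 and h''/h. Their sum is tanh^2, which with c^2 = N
    - 2 balances the term c^2 tanh^2 f in the second derivative.\<close>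
  have tanh: "(1 - (1 - (tanh t)\<^sup>2)\<^sup>2) / (tanh t)\<^sup>2 = 2 - (tanh t)\<^sup>2"
    "- 2 * tanh t * (1 - (tanh t)\<^sup>2) / tanh t = - 2 * (1 - (tanh t)\<^sup>2)" if "t \<in> I" for t
    using h_pos[OF that] by (auto simp: field_simps power2_eq_square)
  have "static_perfect_fluid_space TYPE('n) (I \<times> (sphere 0 1 :: (real^'n) set))
    (warped_metric tanh) (\<lambda>p. f (fst p)) (\<lambda>p. \<rho> (fst p)) (\<lambda>p. \<mu> (fst p))"
  proof (rule static_perfect_fluid_space_warped[OF _ smooth_f smooth_\<mu> smooth_\<rho> f_pos f_deriv f'_deriv])
    fix t assume t: "t \<in> I"
    note T = tanh[OF t]
    have "tanh t > 0" using h_pos[OF t] .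
    then show "c * (1 - (tanh t)\<^sup>2) * q t - c * c * (tanh t)\<^sup>2 * f t - (1 - (tanh t)\<^sup>2) / tanh t * (c * tanh t * q t) =
      - (real CARD('n) - 2) * (- 2 * tanh t * (1 - (tanh t)\<^sup>2) / tanh t + (1 - (1 - (tanh t)\<^sup>2)\<^sup>2) / (tanh t)\<^sup>2) * f t"
      unfolding T c2 N_def[symmetric] by (simp add: field_simps)
    show "\<mu> t = (real CARD('n) - 1) / 2 * ((real CARD('n) - 2) * ((1 - (1 - (tanh t)\<^sup>2)\<^sup>2) / (tanh t)\<^sup>2)
        - 2 * (- 2 * tanh t * (1 - (tanh t)\<^sup>2) / tanh t))"
      unfolding T N_def[symmetric] \<mu>_def by simp
    have "(N - 2) * \<mu> t + N * \<rho> t =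
        (N - 1) * (N * (1 - (tanh t)\<^sup>2) * c * q t / f t - c * c * (tanh t)\<^sup>2)"
      unfolding \<rho>_def using N by simp
    then have "((N - 2) * \<mu> t + N * \<rho> t) / (N - 1) * f t =
        N * (1 - (tanh t)\<^sup>2) * c * q t - c * c * (tanh t)\<^sup>2 * f t"
      using N f_pos[OF t] by (simp add: field_simps)
    also have "\<dots> = c * (1 - (tanh t)\<^sup>2) * q t - c * c * (tanh t)\<^sup>2 * f t
        + (N - 1) * ((1 - (tanh t)\<^sup>2) / tanh t) * (c * tanh t * q t)"
      using \<open>tanh t > 0\<close> by (simp add: field_simps)
    finally show "((real CARD('n) - 2) * \<mu> t + real CARD('n) * \<rho> t) / (real CARD('n) - 1) * f t =
        c * (1 - (tanh t)\<^sup>2) * q t - c * c * (tanh t)\<^sup>2 * f t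
        + (real CARD('n) - 1) * ((1 - (tanh t)\<^sup>2) / tanh t) * (c * tanh t * q t)"
      by (simp add: N_def)
  qed (use n in auto)
  then show ?thesis by blast
qed

theorem theorem6p3:
  fixes I :: "real set"
    and g :: "real \<times> (real^'n) \<Rightarrow> real \<times> (real^'n) \<Rightarrow> real \<times> (real^'n) \<Rightarrow> real"
    and lapse :: "real \<Rightarrow> real \<Rightarrow> real \<Rightarrow> real"
  assumes n: "CARD('n) \<ge> 3"
    and I: "open I" "is_interval I" "I \<subseteq> {0<..}"
  defines "g \<equiv> warped_metric tanh"
    and "lapse \<equiv> (\<lambda>A B r. A * sin (sqrt (real CARD('n) - 2) * ln (cosh r))
                          + B * cos (sqrt (real CARD('n) - 2) * ln (cosh r)))"
  shows "(\<forall>A B. (\<forall>r\<in>I. lapse A B r > 0) \<longrightarrow>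
            (\<exists>\<rho> \<mu>. static_perfect_fluid_space TYPE('n) (I \<times> sphere 0 1) g
                     (\<lambda>p. lapse A B (fst p)) \<rho> \<mu>)) \<and>
         positive_sectional_curvature TYPE('n) (I \<times> sphere 0 1) g \<and>
         extends_smoothly_through_origin g"
proof (intro conjI allI impI)
  interpret warping_function I tanh "\<lambda>t. 1 - (tanh t)\<^sup>2" "\<lambda>t. - 2 * tanh t * (1 - (tanh t)\<^sup>2)"
    by (rule warping_function_tanh[OF I(1,3)])
  show "\<exists>\<rho> \<mu>. static_perfect_fluid_space TYPE('n) (I \<times> sphere 0 1) g
      (\<lambda>p. lapse A B (fst p)) \<rho> \<mu>" if "\<forall>r\<in>I. lapse A B r > 0" for A B
    using static_perfect_fluid_space_tanh[OF n I(1,3), of A B] that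
    unfolding g_def lapse_def by blast
  show "positive_sectional_curvature TYPE('n) (I \<times> sphere 0 1) g"
    unfolding g_def
  proof (rule positive_sectional_curvature_warped)
    fix t assume "t \<in> I"
    from h_pos[OF this] have T: "tanh t > 0" "(tanh t)\<^sup>2 < 1"
      using tanh_real_lt_1[of t] tanh_real_gt_neg1[of t] by (simp_all add: abs_square_less_1)
    then show "- 2 * tanh t * (1 - (tanh t)\<^sup>2) < 0"
      by (intro mult_neg_pos) auto
    show "(1 - (tanh t)\<^sup>2)\<^sup>2 < 1"
      unfolding abs_square_less_1 abs_less_iff using T(2) zero_less_power[OF T(1), of 2]
      by (intro conjI; linarith)
  qed
  show "extends_smoothly_through_origin g"
    unfolding g_def by (rule tanh_warped_metric_extends)
qed

end
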